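(* Let $\Omega\subset\mathbb{R}^n$, $n\ge 2$, be a bounded domain, and let $a\in C(\Omega)\cap L^\infty(\Omega)$ with $a(x)>0$ in $\Omega$. Let $u\in C(\overline{\Omega})$, $u>0$ in $\Omega$, $\sup_{\Omega}u=1$, be a first eigenfunction, that is, $$\Delta_\infty u+\lambda_\Omega a(x)u^3=0\ \text{ in }\Omega,\quad\text{and}\quad u=0\ \text{ on }\partial\Omega.$$ For $0<t<1$, set $\Omega_t=\{x\in\Omega:\ u(x)>t\}$. Then $\lambda_{\Omega_t}$ is increasing in $t$ and $\lim_{t\uparrow 1}\lambda_{\Omega_t}=\infty$.
   Context: The infinity-Laplacian is $\Delta_\infty u=\sum_{i,j=1}^n \frac{\partial u}{\partial x_i}\frac{\partial u}{\partial x_j}\frac{\partial^2 u}{\partial x_i\partial x_j}$. Differential equations are understood in the viscosity sense: for an open set $\Omega$ and $F\in C(\Omega\times\mathbb{R})$, a function $u\in C(\Omega)$ satisfies $\Delta_\infty u\ge F(x,u)$ in $\Omega$ if, whenever $\psi\in C^2(\Omega)$ and $u-\psi$ has a local maximum at $p\in\Omega$, one has $\Delta_\infty\psi(p)\ge F(p,u(p))$; it satisfies $\Delta_\infty u\le F(x,u)$ in $\Omega$ if, whenever $\psi\in C^2(\Omega)$ and $u-\psi$ has a local minimum at $q\in\Omega$, one has $\Delta_\infty\psi(q)\le F(q,u(q))$; $\Delta_\infty u=F(x,u)$ means both. Here $\Delta_\infty u+\lambda a(x)u^3=0$ means $\Delta_\infty u=-\lambda a(x)u^3$. For a non-empty open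 subset $U\subseteq\Omega$, the first eigenvalue $\lambda_U$ (with weight $a$ restricted to $U$) is $\lambda_U=\sup S(U)$, where, for a fixed $\delta>0$, $S(U)$ is the set of all $\lambda\ge 0$ such that the problem $\Delta_\infty w+\lambda a(x)w^3=0$ in $U$, $w=\delta$ on $\partial U$, has a positive solution $w\in C(\overline{U})$. By scaling, $S(U)$ does not depend on $\delta>0$. *)

theory Defs
  imports "HOL-Analysis.Analysis"
begin

definition partial :: "'n::finite \<Rightarrow> (real^'n \<Rightarrow> real) \<Rightarrow> real^'n \<Rightarrow> real" where
  "partial i f x = frechet_derivative f (at x) (axis i 1)"

text \<open>\<open>C\<^sup>2\<close> on an open set: a differentiable function whose first partials are differentiable
  and whose second partials are continuous. The values of \<open>partial\<close> are meaningful here because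
  differentiability is demanded first.\<close>

definition C2_on :: "(real^'n::finite) set \<Rightarrow> (real^'n \<Rightarrow> real) \<Rightarrow> bool" where
  "C2_on \<Omega> f \<longleftrightarrow>
     (\<forall>x\<in>\<Omega>. f differentiable (at x)) \<and>
     (\<forall>i. \<forall>x\<in>\<Omega>. partial i f differentiable (at x)) \<and>
     (\<forall>i j. continuous_on \<Omega> (partial i (partial j f)))"

definition inf_laplacian :: "(real^'n::finite \<Rightarrow> real) \<Rightarrow> real^'n \<Rightarrow> real" where
  "inf_laplacian f x =
     (\<Sum>i\<in>UNIV. \<Sum>j\<in>UNIV. partial i f x * partial j f x * partial i (partial j f) x)"

text \<open>Viscosity inequalities on an open set; they are meant for right-hand sides \<open>F\<close> that are
  continuous on \<open>\<Omega> \<times> \<real>\<close>. Functions are total, but only their values on \<open>\<Omega>\<close> matter.\<close>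

definition visc_ge ::
  "(real^'n::finite) set \<Rightarrow> (real^'n \<Rightarrow> real \<Rightarrow> real) \<Rightarrow> (real^'n \<Rightarrow> real) \<Rightarrow> bool" where
  "visc_ge \<Omega> F u \<longleftrightarrow> continuous_on \<Omega> u \<and>
     (\<forall>\<psi> p. C2_on \<Omega> \<psi> \<and> p \<in> \<Omega> \<and>
        (\<forall>\<^sub>F x in at p within \<Omega>. u x - \<psi> x \<le> u p - \<psi> p) \<longrightarrow>
        inf_laplacian \<psi> p \<ge> F p (u p))"

definition visc_le ::
  "(real^'n::finite) set \<Rightarrow> (real^'n \<Rightarrow> real \<Rightarrow> real) \<Rightarrow> (real^'n \<Rightarrow> real) \<Rightarrow> bool" where
  "visc_le \<Omega> F u \<longleftrightarrow> continuous_on \<Omega> u \<and>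
     (\<forall>\<psi> q. C2_on \<Omega> \<psi> \<and> q \<in> \<Omega> \<and>
        (\<forall>\<^sub>F x in at q within \<Omega>. u x - \<psi> x \<ge> u q - \<psi> q) \<longrightarrow>
        inf_laplacian \<psi> q \<le> F q (u q))"

definition visc_eq ::
  "(real^'n::finite) set \<Rightarrow> (real^'n \<Rightarrow> real \<Rightarrow> real) \<Rightarrow> (real^'n \<Rightarrow> real) \<Rightarrow> bool" where
  "visc_eq \<Omega> F u \<longleftrightarrow> visc_ge \<Omega> F u \<and> visc_le \<Omega> F u"

definition eigen_equation ::
  "(real^'n::finite \<Rightarrow> real) \<Rightarrow> real \<Rightarrow> (real^'n) set \<Rightarrow> (real^'n \<Rightarrow> real) \<Rightarrow> bool" where
  "eigen_equation a \<mu> U w \<longleftrightarrow> visc_eq U (\<lambda>x s. - \<mu> * a x * s ^ 3) w"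

definition solvable_set ::
  "real \<Rightarrow> (real^'n::finite \<Rightarrow> real) \<Rightarrow> (real^'n) set \<Rightarrow> real set" where
  "solvable_set \<delta> a U =
     {\<mu>. \<mu> \<ge> 0 \<and> (\<exists>w. continuous_on (closure U) w \<and> (\<forall>x\<in>U. w x > 0) \<and>
                  eigen_equation a \<mu> U w \<and> (\<forall>x\<in>frontier U. w x = \<delta>))}"

text \<open>The supremum is taken in the extended reals, so that it is meaningful without knowing
  beforehand that the set is bounded.\<close>

definition first_eigenvalue ::
  "real \<Rightarrow> (real^'n::finite \<Rightarrow> real) \<Rightarrow> (real^'n) set \<Rightarrow> ereal" where
  "first_eigenvalue \<delta> a U = (SUP \<mu>\<in>solvable_set \<delta> a U. ereal \<mu>)"

text \<open>In the equation the eigenvalue is used as a real number. The default value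
  \<open>real_of_ereal \<infinity> = 0\<close> admits no spurious eigenfunctions: for \<open>\<mu> = 0\<close> the equation is
  \<open>\<Delta>\<^sub>\<infinity> u = 0\<close>, which on a bounded domain with \<open>u = 0\<close> on the boundary has only the
  solution \<open>u = 0\<close>.\<close>

definition first_eigenfunction ::
  "real \<Rightarrow> (real^'n::finite \<Rightarrow> real) \<Rightarrow> (real^'n) set \<Rightarrow> (real^'n \<Rightarrow> real) \<Rightarrow> bool" where
  "first_eigenfunction \<delta> a \<Omega> u \<longleftrightarrow>
     continuous_on (closure \<Omega>) u \<and> (\<forall>x\<in>\<Omega>. u x > 0) \<and>
     eigen_equation a (real_of_ereal (first_eigenvalue \<delta> a \<Omega>)) \<Omega> u \<and>
     (\<forall>x\<in>frontier \<Omega>. u x = 0)"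

end

theory Submission imports Defs begin

text \<open>
Write \<open>\<mu>\<^sub>0\<close> for the first eigenvalue of \<open>\<Omega>\<close> and \<open>\<Omega>\<^sub>t\<close> for the superlevel set, whose closure is a compact
subset of \<open>\<Omega>\<close> because \<open>u\<close> vanishes on the boundary. Everything rests on one observation: if \<open>w > 0\<close>
satisfies \<open>\<Delta>\<^sub>\<infinity> w \<le> - \<mu> a w\<^sup>3\<close>, then subtracting a constant \<open>c\<close> with \<open>0 < c < w\<close> leaves the left side
unchanged but shrinks the cube, so \<open>w - c\<close> is a supersolution for the larger parameter
\<open>\<mu> (w / (w - c))\<^sup>3\<close>. The quotient is bounded below by a constant above 1 as soon as \<open>w\<close> is bounded
by a multiple of \<open>c\<close>.

Blow-up: on \<open>\<Omega>\<^sub>t\<close> take \<open>w = u \<le> 1\<close> and \<open>c = t\<^sup>2 < t\<close>. This gives a positive supersolution for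
\<open>\<mu>\<^sub>0 / (1 - t\<^sup>2)\<^sup>3\<close>, a number that tends to infinity as \<open>t\<close> increases to 1.

Strict monotonicity: let \<open>s < t\<close> and let \<open>w\<close> be a positive solution on \<open>\<Omega>\<^sub>s\<close> for \<open>\<mu>\<close>. The Harnack
inequality (\<open>harnack_compact\<close>) bounds \<open>w\<close> on the closure of \<open>\<Omega>\<^sub>t\<close> by \<open>H\<close> times its infimum there,
separately in each component of \<open>\<Omega>\<^sub>s\<close>, with \<open>H\<close> depending on the two sets only. Subtracting half of
that infimum, a locally constant function, gives a supersolution for \<open>\<theta> \<mu>\<close> with \<open>\<theta> > 1\<close> independent
of \<open>w\<close> and \<open>\<mu>\<close> (\<open>harnack_improvement\<close>). So the eigenvalue of \<open>\<Omega>\<^sub>t\<close> is at least \<open>\<theta>\<close> times that of \<open>\<Omega>\<^sub>s\<close>,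
which is finite (\<open>eigenvalue_bound\<close>) and positive: it is at least \<open>\<mu>\<^sub>0\<close>, and \<open>\<mu>\<^sub>0 > 0\<close> since an
infinity-subharmonic function that vanishes on the boundary cannot be positive inside
(\<open>no_positive_subharmonic\<close>).

It remains to turn a positive supersolution with arbitrary boundary values into a solution with
constant boundary value (\<open>solvable_of_supersolution\<close>). An increasing affine function of \<open>u\<close> with a
large slope is itself a supersolution near the boundary of \<open>\<Omega>\<^sub>t\<close> and serves as a barrier; Perron's
method (\<open>perron\<close>) does the rest. The Perron supremum is continuous because bounded subsolutions are
locally equi-Hoelder: they can be compared with \<open>K \<surd>|x - x\<^sub>0|\<close>, whose infinity-Laplacian is
\<open>- (K\<^sup>3 / 16) |x - x\<^sub>0| powr (- 5 / 2)\<close> and so as negative as desired (\<open>sub_at_hoelder\<close>). With the signs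
reversed, the same comparison function yields the Harnack inequality.

Throughout, the viscosity inequalities are tested pointwise with quadratic polynomials centred at
the point of contact; by Taylor's formula this is the same as testing with \<open>C\<^sup>2\<close> functions.
\<close>

section \<open>Quadratic test polynomials\<close>

text \<open>
The polynomials \<open>z \<mapsto> q \<bullet> z + (z \<bullet> L z) / 2\<close> serve as second-order test functions, written in the
displacement \<open>z\<close> from the point of contact. The infinity-Laplacian at \<open>z = 0\<close> is \<open>q \<bullet> L q\<close>; it depends
on the symmetric part of \<open>L\<close> alone, as does the polynomial, so \<open>L\<close> ranges over all linear maps.
\<close>
definition quad :: "'a::euclidean_space \<Rightarrow> ('a \<Rightarrow> 'a) \<Rightarrow> 'a \<Rightarrow> real" where
  "quad q L z = q \<bullet> z + (z \<bullet> L z) / 2"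

lemma quad_zero [simp]: "linear L \<Longrightarrow> quad q L 0 = 0"
  by (simp add: quad_def linear_0)

lemma quad_scaleR: "linear L \<Longrightarrow> quad (c *\<^sub>R q) (\<lambda>x. c *\<^sub>R L x) z = c * quad q L z"
  by (simp add: quad_def algebra_simps)

lemma quad_add_square: "quad q (\<lambda>x. L x + c *\<^sub>R x) z = quad q L z + c / 2 * (norm z)\<^sup>2"
  by (simp add: quad_def inner_add_right power2_norm_eq_inner field_simps)

lemma linear_add_scaleR: "linear L \<Longrightarrow> linear (\<lambda>x. L x + c *\<^sub>R x)"
  by (intro linear_compose_add linear_compose_scale_right linear_id[unfolded id_def])

lemma continuous_on_quad: "linear L \<Longrightarrow> continuous_on S (\<lambda>x. quad q L (x - p))"
  unfolding quad_def
  by (intro continuous_intros linear_continuous_on_compose[of _ _ L]) auto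

text \<open>
The gradient of the polynomial at the displacement \<open>z\<close>; the adjoint symmetrises \<open>L\<close>.
\<close>
definition quad_grad :: "'a::euclidean_space \<Rightarrow> ('a \<Rightarrow> 'a) \<Rightarrow> 'a \<Rightarrow> 'a" where
  "quad_grad q L z = q + (1/2) *\<^sub>R (L z + adjoint L z)"

text \<open>
Recentring: seen from another point, a test polynomial is again a test polynomial up to a constant.
\<close>
lemma quad_add:
  assumes "linear L"
  shows "quad q L (z + h) = quad q L z + quad (quad_grad q L z) L h"
proof -
  have "z \<bullet> L h = adjoint L z \<bullet> h"
    by (simp add: adjoint_works[OF assms] inner_commute)
  then show ?thesis
    by (simp add: quad_def quad_grad_def linear_add[OF assms] inner_add_left inner_add_right
        inner_commute[of h "L z"] field_simps)
qed

lemma quad_grad_zero [simp]: "linear L \<Longrightarrow> quad_grad q L 0 = q"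
  by (simp add: quad_grad_def linear_0 adjoint_linear)

lemma continuous_on_quad_grad: "linear L \<Longrightarrow> continuous_on S (\<lambda>x. quad_grad q L (x - p))"
  unfolding quad_grad_def
  by (intro continuous_intros linear_continuous_on_compose[of _ _ L]
        linear_continuous_on_compose[of _ _ "adjoint L"] adjoint_linear) auto

text \<open>
First- and second-order conditions for contact of two polynomials. The second is evaluated along the
common gradient, the only direction that the infinity-Laplacian sees.
\<close>
lemma quad_order:
  assumes L: "linear L" and B: "linear B"
    and ev: "\<forall>\<^sub>F x in nhds p. quad b B (x - p) \<le> quad q L (x - p)"
  shows "b = q" "b \<bullet> B b \<le> q \<bullet> L q"
proof -
  have line: "\<forall>\<^sub>F \<tau>::real in at_right 0. quad b B (\<tau> *\<^sub>R d) \<le> quad q L (\<tau> *\<^sub>R d)" for d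
  proof -
    have "((\<lambda>\<tau>. p + \<tau> *\<^sub>R d) \<longlongrightarrow> p + 0 *\<^sub>R d) (at_right (0::real))"
      by (intro tendsto_intros)
    then have "filterlim (\<lambda>\<tau>. p + \<tau> *\<^sub>R d) (nhds p) (at_right (0::real))" by simp
    from eventually_compose_filterlim[OF ev this] show ?thesis by simp
  qed
  have quad_line: "quad c M (\<tau> *\<^sub>R d) = \<tau> * (c \<bullet> d) + \<tau>\<^sup>2 * (d \<bullet> M d) / 2"
    if "linear M" for c d \<tau> and M :: "'a \<Rightarrow> 'a"
    by (simp add: quad_def linear_scale[OF that] power2_eq_square)
  define d where "d = b - q"
  have "\<forall>\<^sub>F \<tau>::real in at_right 0. (norm d)\<^sup>2 \<le> \<tau> * (d \<bullet> L d - d \<bullet> B d) / 2"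
    using line[of d] eventually_at_right_less[of "0::real"]
  proof eventually_elim
    case (elim \<tau>)
    have "\<tau> * (b \<bullet> d) + \<tau>\<^sup>2 * (d \<bullet> B d) / 2 \<le> \<tau> * (q \<bullet> d) + \<tau>\<^sup>2 * (d \<bullet> L d) / 2"
      using elim(1) by (simp only: quad_line[OF L] quad_line[OF B])
    then have "\<tau> * (norm d)\<^sup>2 \<le> \<tau> * (\<tau> * (d \<bullet> L d - d \<bullet> B d) / 2)"
      unfolding power2_norm_eq_inner
      by (simp add: d_def[THEN arg_cong, of "\<lambda>y. y \<bullet> d"] inner_diff_left field_simps power2_eq_square)
    with elim(2) show ?case by simp
  qed
  moreover have "((\<lambda>\<tau>. \<tau> * (d \<bullet> L d - d \<bullet> B d) / 2) \<longlongrightarrow> 0 * (d \<bullet> L d - d \<bullet> B d) / 2) (at_right (0::real))"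
    by (intro tendsto_intros) auto
  ultimately have "(norm d)\<^sup>2 \<le> 0"
    by (intro tendsto_lowerbound[of _ _ "at_right (0::real)"]) auto
  then show bq: "b = q" by (simp add: d_def)
  have "\<exists>\<tau>::real. \<tau> > 0 \<and> quad b B (\<tau> *\<^sub>R b) \<le> quad q L (\<tau> *\<^sub>R b)"
    using eventually_happens'[OF _ eventually_conj[OF line[of b] eventually_at_right_less[of "0::real"]]]
    by auto
  then obtain \<tau>::real where "\<tau> > 0" "quad b B (\<tau> *\<^sub>R b) \<le> quad q L (\<tau> *\<^sub>R b)" by auto
  then show "b \<bullet> B b \<le> q \<bullet> L q"
    unfolding bq by (simp add: quad_line L B)
qed

text \<open>
The mean value theorem along the segment from \<open>p\<close> to \<open>x\<close> converts the first-order accuracy of the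
gradient field \<open>G\<close>, given by its derivative \<open>L\<close> at \<open>p\<close>, into second-order accuracy of the function.
\<close>
lemma taylor_quad:
  fixes \<phi> :: "'a::euclidean_space \<Rightarrow> real"
  assumes grad: "\<forall>\<^sub>F x in nhds p. (\<phi> has_derivative (\<lambda>h. G x \<bullet> h)) (at x)"
    and G: "(G has_derivative L) (at p)" and "\<epsilon> > 0"
  shows "\<forall>\<^sub>F x in nhds p. \<bar>\<phi> x - \<phi> p - quad (G p) L (x - p)\<bar> \<le> \<epsilon> * (norm (x - p))\<^sup>2"
proof -
  have L: "linear L" using G by (rule has_derivative_linear)
  obtain d1 where d1: "d1 > 0" "\<And>x. dist x p < d1 \<Longrightarrow> (\<phi> has_derivative (\<lambda>h. G x \<bullet> h)) (at x)"
    using grad unfolding eventually_nhds_metric by blast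
  obtain d2 where d2: "d2 > 0"
    "\<And>x. norm (x - p) < d2 \<Longrightarrow> norm (G x - G p - L (x - p)) \<le> \<epsilon> * norm (x - p)"
    using G \<open>\<epsilon> > 0\<close> unfolding has_derivative_at_alt by blast
  have "\<bar>\<phi> x - \<phi> p - quad (G p) L (x - p)\<bar> \<le> \<epsilon> * (norm (x - p))\<^sup>2" if x: "dist x p < min d1 d2" for x
  proof -
    define z where "z = x - p"
    define k where "k \<tau> = \<phi> (p + \<tau> *\<^sub>R z) - \<tau> * (G p \<bullet> z) - \<tau>\<^sup>2 * (z \<bullet> L z) / 2" for \<tau>
    have near: "norm (\<tau> *\<^sub>R z) < min d1 d2" if "0 \<le> \<tau>" "\<tau> \<le> 1" for \<tau>
    proof -
      have "norm (\<tau> *\<^sub>R z) \<le> norm z" using that by (simp add: mult_left_le_one_le)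
      also have "\<dots> < min d1 d2" using x by (simp add: z_def dist_norm)
      finally show ?thesis .
    qed
    have "norm (k 1 - k 0) \<le> (\<epsilon> * (norm z)\<^sup>2) * norm (1 - 0 :: real)"
    proof (rule differentiable_bound[of "{0..1}" k "\<lambda>\<tau> h. h * (G (p + \<tau> *\<^sub>R z) \<bullet> z - G p \<bullet> z - \<tau> * (z \<bullet> L z))"])
      fix \<tau> :: real assume t: "\<tau> \<in> {0..1}"
      have "dist (p + \<tau> *\<^sub>R z) p < d1" using near[of \<tau>] t by (simp add: dist_norm)
      from d1(2)[OF this] have k1: "((\<lambda>\<tau>. \<phi> (p + \<tau> *\<^sub>R z)) has_derivative (\<lambda>h. G (p + \<tau> *\<^sub>R z) \<bullet> (h *\<^sub>R z))) (at \<tau>)"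
      proof (rule has_derivative_compose[rotated])
        show "((\<lambda>\<tau>. p + \<tau> *\<^sub>R z) has_derivative (\<lambda>h. h *\<^sub>R z)) (at \<tau>)"
          by (auto intro!: derivative_eq_intros)
      qed
      have k2: "((\<lambda>\<tau>. \<tau> * c) has_derivative (\<lambda>h. h * c)) (at \<tau>)" for c :: real
        by (auto intro!: derivative_eq_intros)
      have k3: "((\<lambda>\<tau>. \<tau>\<^sup>2 * c / 2) has_derivative (\<lambda>h. h * (\<tau> * c))) (at \<tau>)" for c :: real
        by (auto intro!: derivative_eq_intros)
      have "(k has_derivative (\<lambda>h. G (p + \<tau> *\<^sub>R z) \<bullet> (h *\<^sub>R z) - h * (G p \<bullet> z) - h * (\<tau> * (z \<bullet> L z)))) (at \<tau>)"
        unfolding k_def[abs_def] by (rule has_derivative_diff[OF has_derivative_diff[OF k1 k2] k3])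
      then show "(k has_derivative (\<lambda>h. h * (G (p + \<tau> *\<^sub>R z) \<bullet> z - G p \<bullet> z - \<tau> * (z \<bullet> L z)))) (at \<tau> within {0..1})"
        by (rule has_derivative_at_withinI[OF back_subst[where P="\<lambda>f. (k has_derivative f) (at \<tau>)"]]) (simp add: right_diff_distrib)
      have "norm ((p + \<tau> *\<^sub>R z) - p) < d2" using near[of \<tau>] t by simp
      from d2(2)[OF this] have e: "norm (G (p + \<tau> *\<^sub>R z) - G p - \<tau> *\<^sub>R L z) \<le> \<epsilon> * (\<tau> * norm z)"
        using t by (simp add: linear_scale[OF L])
      have "\<bar>G (p + \<tau> *\<^sub>R z) \<bullet> z - G p \<bullet> z - \<tau> * (z \<bullet> L z)\<bar> = \<bar>(G (p + \<tau> *\<^sub>R z) - G p - \<tau> *\<^sub>R L z) \<bullet> z\<bar>"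
        by (simp add: algebra_simps inner_commute)
      also have "\<dots> \<le> norm (G (p + \<tau> *\<^sub>R z) - G p - \<tau> *\<^sub>R L z) * norm z"
        by (rule Cauchy_Schwarz_ineq2)
      also have "\<dots> \<le> \<epsilon> * (\<tau> * norm z) * norm z" using e by (intro mult_right_mono) auto
      also have "\<dots> = \<tau> * (\<epsilon> * (norm z)\<^sup>2)" by (simp add: power2_eq_square)
      also have "\<dots> \<le> 1 * (\<epsilon> * (norm z)\<^sup>2)" using t \<open>\<epsilon> > 0\<close> by (intro mult_right_mono) auto
      finally have "\<bar>G (p + \<tau> *\<^sub>R z) \<bullet> z - G p \<bullet> z - \<tau> * (z \<bullet> L z)\<bar> \<le> \<epsilon> * (norm z)\<^sup>2" by simp
      then show "onorm (\<lambda>h. h * (G (p + \<tau> *\<^sub>R z) \<bullet> z - G p \<bullet> z - \<tau> * (z \<bullet> L z))) \<le> \<epsilon> * (norm z)\<^sup>2"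
        by (intro onorm_bound) (auto simp: abs_mult \<open>\<epsilon> > 0\<close> less_imp_le mult.commute[of "\<epsilon> * _"] intro!: mult_left_mono)
    qed auto
    then show ?thesis by (simp add: k_def z_def quad_def algebra_simps)
  qed
  with d1(1) d2(1) show ?thesis
    unfolding eventually_nhds_metric by (intro exI[of _ "min d1 d2"]) auto
qed

section \<open>Pointwise viscosity inequalities\<close>

text \<open>
The two halves of the viscosity notion at a single point. Keeping the point separate from the domain
makes gluing trivial: a function inherits the inequality at a point from any other that touches it there
from the correct side.
\<close>
definition sub_at :: "('a::euclidean_space \<Rightarrow> real \<Rightarrow> real) \<Rightarrow> ('a \<Rightarrow> real) \<Rightarrow> 'a \<Rightarrow> bool" where
  "sub_at F v p \<longleftrightarrow> (\<forall>q L. linear L \<longrightarrow>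
     (\<forall>\<^sub>F x in nhds p. v x \<le> v p + quad q L (x - p)) \<longrightarrow> F p (v p) \<le> q \<bullet> L q)"

definition super_at :: "('a::euclidean_space \<Rightarrow> real \<Rightarrow> real) \<Rightarrow> ('a \<Rightarrow> real) \<Rightarrow> 'a \<Rightarrow> bool" where
  "super_at F w p \<longleftrightarrow> (\<forall>q L. linear L \<longrightarrow>
     (\<forall>\<^sub>F x in nhds p. w p + quad q L (x - p) \<le> w x) \<longrightarrow> q \<bullet> L q \<le> F p (w p))"

text \<open>
Contact with a function is contact with its Taylor polynomial after adding \<open>\<epsilon> |x - p|\<^sup>2\<close>, and this
raises the infinity-Laplacian by a multiple of \<open>\<epsilon>\<close> only.
\<close>
lemma sub_at_smooth:
  assumes sub: "sub_at F v p" and touch: "\<forall>\<^sub>F x in nhds p. v x - \<phi> x \<le> v p - \<phi> p"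
    and grad: "\<forall>\<^sub>F x in nhds p. (\<phi> has_derivative (\<lambda>h. G x \<bullet> h)) (at x)"
    and G: "(G has_derivative L) (at p)"
  shows "F p (v p) \<le> G p \<bullet> L (G p)"
proof -
  have L: "linear L" using G by (rule has_derivative_linear)
  have le: "F p (v p) \<le> G p \<bullet> L (G p) + \<epsilon> * (2 * (norm (G p))\<^sup>2)" if "\<epsilon> > 0" for \<epsilon>
  proof -
    have "\<forall>\<^sub>F x in nhds p. v x \<le> v p + quad (G p) (\<lambda>x. L x + (2 * \<epsilon>) *\<^sub>R x) (x - p)"
      using taylor_quad[OF grad G that] touch
      by eventually_elim (auto simp: quad_add_square)
    from sub[unfolded sub_at_def, rule_format, OF linear_add_scaleR[OF L] this]
    show ?thesis by (simp add: inner_add_right power2_norm_eq_inner)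
  qed
  have "((\<lambda>\<epsilon>. G p \<bullet> L (G p) + \<epsilon> * (2 * (norm (G p))\<^sup>2)) \<longlongrightarrow> G p \<bullet> L (G p) + 0 * (2 * (norm (G p))\<^sup>2)) (at_right 0)"
    by (intro tendsto_intros)
  then have "F p (v p) \<le> G p \<bullet> L (G p) + 0 * (2 * (norm (G p))\<^sup>2)"
  proof (rule tendsto_lowerbound)
    show "\<forall>\<^sub>F \<epsilon> in at_right 0. F p (v p) \<le> G p \<bullet> L (G p) + \<epsilon> * (2 * (norm (G p))\<^sup>2)"
      using eventually_at_right_less[of 0] by eventually_elim (rule le)
  qed simp
  then show ?thesis by simp
qed

lemma super_at_iff_sub_at: "super_at F w p \<longleftrightarrow> sub_at (\<lambda>x s. - F x (- s)) (\<lambda>x. - w x) p"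
proof -
  have neg: "quad (- q) (\<lambda>x. - L x) z = - quad q L z" for q L and z :: 'a
    by (simp add: quad_def)
  show ?thesis
  proof
    assume s: "super_at F w p"
    show "sub_at (\<lambda>x s. - F x (- s)) (\<lambda>x. - w x) p"
      unfolding sub_at_def
    proof (intro allI impI)
      fix q L assume L: "linear L" and ev: "\<forall>\<^sub>F x in nhds p. - w x \<le> - w p + quad q L (x - p)"
      have "\<forall>\<^sub>F x in nhds p. w p + quad (- q) (\<lambda>x. - L x) (x - p) \<le> w x"
        using ev by eventually_elim (simp add: neg)
      from s[unfolded super_at_def, rule_format, OF linear_compose_neg[OF L] this]
      show "- F p (- (- w p)) \<le> q \<bullet> L q" by (simp add: linear_neg[OF L])
    qed
  next
    assume s: "sub_at (\<lambda>x s. - F x (- s)) (\<lambda>x. - w x) p"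
    show "super_at F w p"
      unfolding super_at_def
    proof (intro allI impI)
      fix q L assume L: "linear L" and ev: "\<forall>\<^sub>F x in nhds p. w p + quad q L (x - p) \<le> w x"
      have "\<forall>\<^sub>F x in nhds p. - w x \<le> - w p + quad (- q) (\<lambda>x. - L x) (x - p)"
        using ev by eventually_elim (simp add: neg)
      from s[unfolded sub_at_def, rule_format, OF linear_compose_neg[OF L] this]
      show "q \<bullet> L q \<le> F p (w p)" by (simp add: linear_neg[OF L])
    qed
  qed
qed

lemma quad_test_function:
  fixes p q :: "real^'n::finite"
  assumes L: "linear L"
  shows "C2_on U (\<lambda>x. quad q L (x - p))" "inf_laplacian (\<lambda>x. quad q L (x - p)) p = q \<bullet> L q"
proof -
  let ?\<psi> = "\<lambda>x. quad q L (x - p)"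
  let ?e = "\<lambda>i::'n. axis i (1::real)"
  have bl: "bounded_linear L" using L by (simp add: linear_conv_bounded_linear)
  note [derivative_intros] = bounded_linear.has_derivative[OF bl]
  have d: "(?\<psi> has_derivative (\<lambda>h. q \<bullet> h + (h \<bullet> L (x - p) + (x - p) \<bullet> L h) / 2)) (at x)" for x
    unfolding quad_def
    by (auto intro!: derivative_eq_intros simp: fun_eq_iff)
  have p1: "partial i ?\<psi> = (\<lambda>x. q \<bullet> ?e i + (?e i \<bullet> L (x - p) + (x - p) \<bullet> L (?e i)) / 2)" for i
    by (simp add: fun_eq_iff partial_def frechet_derivative_at[OF d, symmetric])
  have d2: "(partial i ?\<psi> has_derivative (\<lambda>h. (?e i \<bullet> L h + h \<bullet> L (?e i)) / 2)) (at x)" for i x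
    unfolding p1 by (auto intro!: derivative_eq_intros simp: fun_eq_iff)
  have p2: "partial i (partial j ?\<psi>) = (\<lambda>x. (?e j \<bullet> L (?e i) + ?e i \<bullet> L (?e j)) / 2)" for i j
    unfolding partial_def[of i] frechet_derivative_at[OF d2, symmetric] by simp
  show "C2_on U ?\<psi>"
    unfolding C2_on_def p2 using d d2 by (auto simp: differentiable_def)
  have p1p: "partial i ?\<psi> p = q $ i" for i
    by (simp add: p1 linear_0[OF L] inner_axis)
  have Lq: "L q = (\<Sum>j\<in>UNIV. q $ j *\<^sub>R L (?e j))"
    by (subst basis_expansion[of q, symmetric])
       (simp add: linear_sum[OF L] linear_scale[OF L] scalar_mult_eq_scaleR)
  have s: "(\<Sum>i\<in>UNIV. \<Sum>j\<in>UNIV. q $ i * q $ j * (?e i \<bullet> L (?e j))) = q \<bullet> L q"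
    unfolding Lq by (simp add: inner_vec_def[of q] inner_axis' sum_distrib_left algebra_simps)
  have s': "(\<Sum>i\<in>UNIV. \<Sum>j\<in>UNIV. q $ i * q $ j * (?e j \<bullet> L (?e i))) = q \<bullet> L q"
    by (subst sum.swap) (simp add: s[symmetric] mult.commute mult.left_commute)
  have "inf_laplacian ?\<psi> p = (\<Sum>i\<in>UNIV. \<Sum>j\<in>UNIV. q $ i * q $ j * ((?e j \<bullet> L (?e i) + ?e i \<bullet> L (?e j)) / 2))"
    by (simp add: inf_laplacian_def p1p p2)
  also have "\<dots> = ((\<Sum>i\<in>UNIV. \<Sum>j\<in>UNIV. q $ i * q $ j * (?e j \<bullet> L (?e i))) +
      (\<Sum>i\<in>UNIV. \<Sum>j\<in>UNIV. q $ i * q $ j * (?e i \<bullet> L (?e j)))) / 2"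
    by (simp add: sum.distrib[symmetric] sum_divide_distrib algebra_simps add_divide_distrib)
  finally show "inf_laplacian ?\<psi> p = q \<bullet> L q" by (simp add: s s')
qed

lemma C2_gradient:
  fixes \<psi> :: "real^'n::finite \<Rightarrow> real"
  assumes "C2_on U \<psi>" "p \<in> U"
  shows "(\<psi> has_derivative (\<lambda>h. (\<chi> i. partial i \<psi> p) \<bullet> h)) (at p)"
    and "\<exists>L. ((\<lambda>x. \<chi> i. partial i \<psi> x) has_derivative L) (at p) \<and>
      (\<chi> i. partial i \<psi> p) \<bullet> L (\<chi> i. partial i \<psi> p) = inf_laplacian \<psi> p"
proof -
  have expand: "frechet_derivative f (at p) h = (\<Sum>i\<in>UNIV. h $ i * partial i f p)"
    if "f differentiable (at p)" for f :: "real^'n \<Rightarrow> real" and h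
  proof -
    have lin: "linear (frechet_derivative f (at p))"
      using that by (rule linear_frechet_derivative)
    show ?thesis
      by (subst basis_expansion[of h, symmetric])
        (simp add: linear_sum[OF lin] linear_scale[OF lin] scalar_mult_eq_scaleR partial_def)
  qed
  have d: "\<psi> differentiable (at p)" and dp: "\<And>i. partial i \<psi> differentiable (at p)"
    using assms by (auto simp: C2_on_def)
  have "(\<psi> has_derivative frechet_derivative \<psi> (at p)) (at p)"
    using d frechet_derivative_works by blast
  moreover have "frechet_derivative \<psi> (at p) = (\<lambda>h. (\<chi> i. partial i \<psi> p) \<bullet> h)"
    by (simp add: fun_eq_iff expand[OF d] inner_vec_def mult.commute)
  ultimately show "(\<psi> has_derivative (\<lambda>h. (\<chi> i. partial i \<psi> p) \<bullet> h)) (at p)" by simp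
  define L where "L h = (\<chi> i. frechet_derivative (partial i \<psi>) (at p) h)" for h
  have "((\<lambda>x. \<chi> i. partial i \<psi> x) has_derivative L) (at p)"
    unfolding L_def
    by (subst has_derivative_componentwise_within)
      (use dp frechet_derivative_works in \<open>auto simp: Basis_vec_def inner_axis\<close>)
  moreover have "(\<chi> i. partial i \<psi> p) \<bullet> L (\<chi> i. partial i \<psi> p) = inf_laplacian \<psi> p"
    unfolding inf_laplacian_def
    by (subst sum.swap)
      (simp add: inner_vec_def L_def expand[OF dp] sum_distrib_left algebra_simps)
  ultimately show "\<exists>L. ((\<lambda>x. \<chi> i. partial i \<psi> x) has_derivative L) (at p) \<and>
      (\<chi> i. partial i \<psi> p) \<bullet> L (\<chi> i. partial i \<psi> p) = inf_laplacian \<psi> p" by blast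
qed

lemma eventually_nhds_iff_at:
  assumes "open U" "p \<in> U" "P p"
  shows "(\<forall>\<^sub>F x in at p within U. P x) \<longleftrightarrow> (\<forall>\<^sub>F x in nhds p. P x)"
proof -
  have "(x \<noteq> p \<longrightarrow> P x) = P x" for x using assms(3) by auto
  then show ?thesis
    by (simp only: at_within_open[OF assms(2,1)] eventually_at_filter UNIV_I simp_thms)
qed

text \<open>
Quadratic polynomials are \<open>C\<^sup>2\<close>, and conversely a \<open>C\<^sup>2\<close> test function may be replaced by its Taylor
polynomial. The same holds for supersolutions below.
\<close>
lemma visc_ge_iff:
  assumes U: "open U"
  shows "visc_ge U F v \<longleftrightarrow> continuous_on U v \<and> (\<forall>p\<in>U. sub_at F v p)"
proof (intro iffI conjI ballI)
  assume v: "visc_ge U F v"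
  then show "continuous_on U v" by (simp add: visc_ge_def)
  fix p assume p: "p \<in> U"
  show "sub_at F v p"
    unfolding sub_at_def
  proof (intro allI impI)
    fix q L assume L: "linear L" and ev: "\<forall>\<^sub>F x in nhds p. v x \<le> v p + quad q L (x - p)"
    have "\<forall>\<^sub>F x in at p within U. v x - quad q L (x - p) \<le> v p - quad q L (p - p)"
      unfolding eventually_nhds_iff_at[OF U p order_refl]
      using ev by eventually_elim (simp add: L)
    then show "F p (v p) \<le> q \<bullet> L q"
      using v[unfolded visc_ge_def, THEN conjunct2, rule_format, of "\<lambda>x. quad q L (x - p)" p]
        quad_test_function[OF L] p by simp
  qed
next
  assume v: "continuous_on U v \<and> (\<forall>p\<in>U. sub_at F v p)"
  show "visc_ge U F v"
    unfolding visc_ge_def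
  proof (intro conjI allI impI)
    show "continuous_on U v" using v by simp
    fix \<psi> p assume a: "C2_on U \<psi> \<and> p \<in> U \<and> (\<forall>\<^sub>F x in at p within U. v x - \<psi> x \<le> v p - \<psi> p)"
    then have ev: "\<forall>\<^sub>F x in at p within U. v x - \<psi> x \<le> v p - \<psi> p" by blast
    from a have p: "p \<in> U" and C2: "C2_on U \<psi>" by auto
    obtain L where L: "((\<lambda>x. \<chi> i. partial i \<psi> x) has_derivative L) (at p)"
      "(\<chi> i. partial i \<psi> p) \<bullet> L (\<chi> i. partial i \<psi> p) = inf_laplacian \<psi> p"
      using C2_gradient(2)[OF C2 p] by blast
    have grad: "\<forall>\<^sub>F x in nhds p. (\<psi> has_derivative (\<lambda>h. (\<chi> i. partial i \<psi> x) \<bullet> h)) (at x)"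
      using eventually_nhds_in_open[OF U p]
      by eventually_elim (rule C2_gradient(1)[OF C2])
    have touch: "\<forall>\<^sub>F x in nhds p. v x - \<psi> x \<le> v p - \<psi> p"
      using ev eventually_nhds_iff_at[OF U p, of "\<lambda>x. v x - \<psi> x \<le> v p - \<psi> p"] by blast
    have "sub_at F v p" using v p by blast
    from sub_at_smooth[OF this touch grad L(1)] show "F p (v p) \<le> inf_laplacian \<psi> p"
      unfolding L(2) .
  qed
qed

lemma visc_le_iff:
  assumes U: "open U"
  shows "visc_le U F w \<longleftrightarrow> continuous_on U w \<and> (\<forall>p\<in>U. super_at F w p)"
proof (intro iffI conjI ballI)
  assume v: "visc_le U F w"
  then show "continuous_on U w" by (simp add: visc_le_def)
  fix p assume p: "p \<in> U"
  show "super_at F w p"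
    unfolding super_at_def
  proof (intro allI impI)
    fix q L assume L: "linear L" and ev: "\<forall>\<^sub>F x in nhds p. w p + quad q L (x - p) \<le> w x"
    have "\<forall>\<^sub>F x in at p within U. w x - quad q L (x - p) \<ge> w p - quad q L (p - p)"
      unfolding eventually_nhds_iff_at[OF U p order_refl]
      using ev by eventually_elim (simp add: L)
    then show "q \<bullet> L q \<le> F p (w p)"
      using v[unfolded visc_le_def, THEN conjunct2, rule_format, of "\<lambda>x. quad q L (x - p)" p]
        quad_test_function[OF L] p by simp
  qed
next
  assume v: "continuous_on U w \<and> (\<forall>p\<in>U. super_at F w p)"
  show "visc_le U F w"
    unfolding visc_le_def
  proof (intro conjI allI impI)
    show "continuous_on U w" using v by simp
    fix \<psi> p assume a: "C2_on U \<psi> \<and> p \<in> U \<and> (\<forall>\<^sub>F x in at p within U. w x - \<psi> x \<ge> w p - \<psi> p)"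
    then have ev: "\<forall>\<^sub>F x in at p within U. w x - \<psi> x \<ge> w p - \<psi> p" by blast
    from a have p: "p \<in> U" and C2: "C2_on U \<psi>" by auto
    let ?G = "\<lambda>x. \<chi> i. partial i \<psi> x"
    obtain L where L: "(?G has_derivative L) (at p)"
      "?G p \<bullet> L (?G p) = inf_laplacian \<psi> p"
      using C2_gradient(2)[OF C2 p] by blast
    have "linear L" using L(1) by (rule has_derivative_linear)
    have grad: "\<forall>\<^sub>F x in nhds p. ((\<lambda>x. - \<psi> x) has_derivative (\<lambda>h. - ?G x \<bullet> h)) (at x)"
      using eventually_nhds_in_open[OF U p]
      by eventually_elim (auto intro!: derivative_eq_intros C2_gradient(1)[OF C2])
    have touch: "\<forall>\<^sub>F x in nhds p. - w x - - \<psi> x \<le> - w p - - \<psi> p"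
      using ev[unfolded eventually_nhds_iff_at[OF U p order_refl]]
      by eventually_elim simp
    have G': "((\<lambda>x. - ?G x) has_derivative (\<lambda>h. - L h)) (at p)"
      by (rule has_derivative_minus[OF L(1)])
    have "sub_at (\<lambda>x s. - F x (- s)) (\<lambda>x. - w x) p"
      using v p by (simp add: super_at_iff_sub_at)
    from sub_at_smooth[OF this touch grad G'] show "inf_laplacian \<psi> p \<le> F p (w p)"
      using L(2) by (simp add: linear_neg[OF \<open>linear L\<close>])
  qed
qed

section \<open>Comparison with the square root of the distance\<close>

text \<open>
A radial function \<open>h(|x - x\<^sub>0|)\<close> has infinity-Laplacian \<open>h'\<^sup>2 h''\<close>, which for \<open>h(\<rho>) = K \<surd>\<rho>\<close> is
\<open>- (K\<^sup>3 / 16) \<rho> powr (- 5 / 2)\<close>. In the proof the function is written through \<open>s = \<rho>\<^sup>2\<close>, which is smooth.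
\<close>
lemma sub_at_touching_sqrt_dist:
  assumes sub: "sub_at F v p" and "p \<noteq> x0"
    and touch: "\<forall>\<^sub>F x in nhds p. v x - K * sqrt (dist x x0) \<le> v p - K * sqrt (dist p x0)"
  shows "F p (v p) \<le> - (K ^ 3 / 16) * dist p x0 powr (- 5 / 2)"
proof -
  define s where "s x = (x - x0) \<bullet> (x - x0)" for x
  define G where "G x = (K / 2 * s x powr (- 3 / 4)) *\<^sub>R (x - x0)" for x
  have pos: "s x > 0" if "x \<noteq> x0" for x using that by (simp add: s_def)
  have dist_s: "dist x x0 = s x powr (1 / 2)" for x
    by (simp add: s_def powr_half_sqrt dist_norm norm_eq_sqrt_inner)
  have sqrt_s: "sqrt (dist x x0) = s x powr (1 / 4)" for x
    by (simp add: dist_s powr_half_sqrt[symmetric] powr_powr)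
  have ds: "(s has_derivative (\<lambda>h. 2 * ((x - x0) \<bullet> h))) (at x)" for x
    unfolding s_def[abs_def]
    by (auto intro!: derivative_eq_intros simp: inner_commute)
  have dpowr: "((\<lambda>x. s x powr r) has_derivative (\<lambda>h. 2 * ((x - x0) \<bullet> h) * (r * s x powr (r - 1)))) (at x)"
    if "x \<noteq> x0" for x r
    by (rule DERIV_compose_FDERIV[OF has_real_derivative_powr[OF pos[OF that]] ds])
  have grad: "((\<lambda>x. K * sqrt (dist x x0)) has_derivative (\<lambda>h. G x \<bullet> h)) (at x)" if "x \<noteq> x0" for x
  proof -
    have "((\<lambda>x. K * s x powr (1 / 4)) has_derivative
        (\<lambda>h. K * (2 * ((x - x0) \<bullet> h) * (1 / 4 * s x powr (1 / 4 - 1))))) (at x)"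
      by (rule has_derivative_mult_right[OF dpowr[OF that]])
    moreover have "(\<lambda>h. K * (2 * ((x - x0) \<bullet> h) * (1 / 4 * s x powr (1 / 4 - 1)))) = (\<lambda>h. G x \<bullet> h)"
      by (simp add: G_def fun_eq_iff)
    ultimately show ?thesis by (simp add: sqrt_s)
  qed
  define L where "L h = (K / 2 * s p powr (- 3 / 4)) *\<^sub>R h
      + (K / 2 * (2 * ((p - x0) \<bullet> h) * (- 3 / 4 * s p powr (- 3 / 4 - 1)))) *\<^sub>R (p - x0)" for h
  have dG: "(G has_derivative L) (at p)"
    unfolding G_def[abs_def] L_def[abs_def]
    by (rule has_derivative_scaleR[OF has_derivative_mult_right[OF dpowr[OF \<open>p \<noteq> x0\<close>]]
        has_derivative_diff[OF has_derivative_ident has_derivative_const, unfolded diff_zero]])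
  have ev: "\<forall>\<^sub>F x in nhds p. x \<noteq> x0"
    using t1_space_nhds[OF \<open>p \<noteq> x0\<close>] .
  define c where "c = K / 2 * s p powr (- 3 / 4)"
  have sp: "s p > 0" using pos \<open>p \<noteq> x0\<close> by simp
  have e1: "s p powr (- 3 / 4 - 1) * s p = s p powr (- 3 / 4)"
    using powr_add[of "s p" "- 3 / 4 - 1" 1] sp by simp
  have Gp: "G p = c *\<^sub>R (p - x0)" by (simp add: G_def c_def)
  have LG: "L (G p) = (- (c\<^sup>2) / 2) *\<^sub>R (p - x0)"
  proof -
    have "L (G p) = (c * c + (K / 2 * (2 * (c * s p) * (- 3 / 4 * s p powr (- 3 / 4 - 1))))) *\<^sub>R (p - x0)"
      by (simp only: L_def Gp c_def[symmetric] s_def[symmetric] inner_scaleR_right scaleR_scaleR scaleR_add_left)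
    also have "K / 2 * (2 * (c * s p) * (- 3 / 4 * s p powr (- 3 / 4 - 1)))
        = - (3 / 4) * K * c * (s p powr (- 3 / 4 - 1) * s p)" by simp
    also have "\<dots> = - (3 / 2) * c * c" unfolding e1 by (simp add: c_def)
    finally show ?thesis by (simp add: power2_eq_square)
  qed
  have c3: "(s p powr (- 3 / 4)) ^ 3 * s p = dist p x0 powr (- 5 / 2)"
  proof -
    have "(s p powr (- 3 / 4)) ^ 3 = s p powr (- 9 / 4)"
      using sp by (simp add: powr_power)
    then have "(s p powr (- 3 / 4)) ^ 3 * s p = s p powr (- 9 / 4 + 1)"
      using sp powr_add[of "s p" "- 9 / 4" 1] by simp
    then show ?thesis by (simp add: dist_s powr_powr)
  qed
  have "F p (v p) \<le> G p \<bullet> L (G p)"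
    by (rule sub_at_smooth[OF sub touch eventually_mono[OF ev grad] dG])
  also have "\<dots> = - (c ^ 3) / 2 * s p"
    unfolding LG unfolding Gp by (simp add: s_def power2_eq_square power3_eq_cube)
  also have "\<dots> = - (K ^ 3 / 16) * ((s p powr (- 3 / 4)) ^ 3 * s p)"
    by (simp add: c_def power_mult_distrib power_divide)
  finally show ?thesis unfolding c3 .
qed

lemma local_max_interior:
  fixes f :: "'a::metric_space \<Rightarrow> real"
  assumes "p \<in> ball x0 R" "\<And>x. x \<in> cball x0 R \<Longrightarrow> f x \<le> f p"
  shows "\<forall>\<^sub>F x in nhds p. f x \<le> f p"
  using eventually_nhds_in_open[OF open_ball assms(1)]
  by eventually_elim (use assms(2) in auto)

text \<open>
Comparison with \<open>K \<surd>|x - x\<^sub>0|\<close> over a ball. The maximum of the difference over the closed ball cannot be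
attained strictly between centre and sphere, where the comparison function would be too concave.
\<close>
lemma sub_at_hoelder:
  assumes v: "continuous_on (cball x0 R) v" and sub: "\<And>p. p \<in> ball x0 R \<Longrightarrow> sub_at F v p"
    and F: "\<And>p. p \<in> ball x0 R \<Longrightarrow> - (K ^ 3 / 16) * R powr (- 5 / 2) < F p (v p)"
    and bd: "\<And>y. y \<in> sphere x0 R \<Longrightarrow> v y \<le> v x0 + K * sqrt R"
    and "K \<ge> 0" and x: "x \<in> cball x0 R"
  shows "v x \<le> v x0 + K * sqrt (dist x x0)"
proof (rule ccontr)
  assume neg: "\<not> ?thesis"
  define f where "f x = v x - K * sqrt (dist x x0)" for x
  have "continuous_on (cball x0 R) f"
    unfolding f_def[abs_def] by (intro continuous_intros v)
  then obtain p where p: "p \<in> cball x0 R" "\<And>x. x \<in> cball x0 R \<Longrightarrow> f x \<le> f p"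
    using continuous_attains_sup[of "cball x0 R" f] x by fastforce
  have fp: "f p > v x0" using p(2)[OF x] neg by (simp add: f_def)
  have "p \<noteq> x0" using fp by (auto simp: f_def)
  have "p \<notin> sphere x0 R" using fp bd[of p] by (auto simp: f_def dist_commute)
  with p(1) have pb: "p \<in> ball x0 R" by auto
  have "F p (v p) \<le> - (K ^ 3 / 16) * dist p x0 powr (- 5 / 2)"
    using sub_at_touching_sqrt_dist[OF sub[OF pb] \<open>p \<noteq> x0\<close>] local_max_interior[of p x0 R f, OF pb p(2)]
    unfolding f_def by blast
  also have "\<dots> \<le> - (K ^ 3 / 16) * R powr (- 5 / 2)"
    using pb \<open>p \<noteq> x0\<close> \<open>K \<ge> 0\<close>
    by (intro mult_left_mono_neg powr_mono2') (auto simp: dist_commute)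
  finally show False using F[OF pb] by simp
qed

section \<open>Operations on sub- and supersolutions\<close>

lemma super_at_mono: "super_at F w p \<Longrightarrow> F p (w p) \<le> F' p (w p) \<Longrightarrow> super_at F' w p"
  unfolding super_at_def by (meson order_trans)

lemma super_at_touching:
  assumes "super_at F w p" "V p = w p" "\<forall>\<^sub>F x in nhds p. V x \<le> w x"
  shows "super_at F V p"
  unfolding super_at_def
proof (intro allI impI)
  fix q L assume L: "linear L" and ev: "\<forall>\<^sub>F x in nhds p. V p + quad q L (x - p) \<le> V x"
  have "\<forall>\<^sub>F x in nhds p. w p + quad q L (x - p) \<le> w x"
    using ev assms(3) by eventually_elim (simp add: assms(2))
  then show "q \<bullet> L q \<le> F p (V p)"
    using assms(1) L unfolding super_at_def assms(2) by blast
qed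

lemma sub_at_touching:
  assumes "sub_at F v p" "V p = v p" "\<forall>\<^sub>F x in nhds p. v x \<le> V x"
  shows "sub_at F V p"
  unfolding sub_at_def
proof (intro allI impI)
  fix q L assume L: "linear L" and ev: "\<forall>\<^sub>F x in nhds p. V x \<le> V p + quad q L (x - p)"
  have "\<forall>\<^sub>F x in nhds p. v x \<le> v p + quad q L (x - p)"
    using ev assms(3) by eventually_elim (simp add: assms(2))
  then show "F p (V p) \<le> q \<bullet> L q"
    using assms(1) L unfolding sub_at_def assms(2) by blast
qed

text \<open>
Both operations used on supersolutions, scaling by \<open>c\<close> and shifting by \<open>d\<close>; the factor \<open>c\<^sup>3\<close> is the
homogeneity of the infinity-Laplacian. The relation is required near \<open>p\<close> only, so \<open>d\<close> may come from a
locally constant function.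
\<close>
lemma super_at_affine:
  assumes w: "super_at F w p" and "c > 0"
    and v: "\<forall>\<^sub>F x in nhds p. v x = c * w x + d"
    and F: "c ^ 3 * F p (w p) \<le> F' p (v p)"
  shows "super_at F' v p"
  unfolding super_at_def
proof (intro allI impI)
  fix q L assume L: "linear L" and ev: "\<forall>\<^sub>F x in nhds p. v p + quad q L (x - p) \<le> v x"
  have vp: "v p = c * w p + d" using v by (rule eventually_nhds_x_imp_x)
  have "\<forall>\<^sub>F x in nhds p. w p + quad ((1 / c) *\<^sub>R q) (\<lambda>x. (1 / c) *\<^sub>R L x) (x - p) \<le> w x"
    using ev v
  proof eventually_elim
    case (elim x)
    then have "c * w p + quad q L (x - p) \<le> c * w x" by (simp add: vp)
    then show ?case using \<open>c > 0\<close>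
      by (simp add: quad_scaleR[OF L] field_simps)
  qed
  from w[unfolded super_at_def, rule_format, OF linear_compose_scale_right[OF L] this]
  have "(q \<bullet> L q) / c ^ 3 \<le> F p (w p)"
    by (simp add: linear_scale[OF L] power3_eq_cube)
  then have "q \<bullet> L q \<le> c ^ 3 * F p (w p)"
    using \<open>c > 0\<close> by (simp add: field_simps)
  with F show "q \<bullet> L q \<le> F' p (v p)" by linarith
qed

section \<open>Harnack inequality\<close>

definition pos_superharmonic :: "'a::euclidean_space set \<Rightarrow> ('a \<Rightarrow> real) \<Rightarrow> bool" where
  "pos_superharmonic U w \<longleftrightarrow> continuous_on U w \<and> (\<forall>x\<in>U. 0 < w x \<and> super_at (\<lambda>_ _. 0) w x)"

text \<open>
For \<open>- w\<close> the comparison constant \<open>w x\<^sub>0 / \<surd>R\<close> is admissible merely because \<open>w\<close> is positive on the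
sphere. The result \<open>w x \<ge> (1 - \<surd>(|x - x\<^sub>0| / R)) w x\<^sub>0\<close> is at least half of \<open>w x\<^sub>0\<close> when
\<open>|x - x\<^sub>0| \<le> R / 4\<close>.
\<close>
lemma harnack_centre:
  assumes w: "pos_superharmonic U w" and "R > 0" and U: "cball x0 R \<subseteq> U" and x: "x \<in> cball x0 (R / 4)"
  shows "w x0 \<le> 2 * w x"
proof -
  have x0: "x0 \<in> U" using U \<open>R > 0\<close> by auto
  have wp: "0 < w y" if "y \<in> U" for y using w that by (simp add: pos_superharmonic_def)
  define K where "K = w x0 / sqrt R"
  have K: "K > 0" using wp[OF x0] \<open>R > 0\<close> by (simp add: K_def)
  have KR: "K * sqrt R = w x0" using \<open>R > 0\<close> by (simp add: K_def)
  have "- w x \<le> - w x0 + K * sqrt (dist x x0)"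
  proof (rule sub_at_hoelder[of x0 R "\<lambda>x. - w x" "\<lambda>_ _. 0"])
    show "continuous_on (cball x0 R) (\<lambda>x. - w x)"
      using w U by (auto simp: pos_superharmonic_def intro!: continuous_intros intro: continuous_on_subset)
    show "sub_at (\<lambda>_ _. 0) (\<lambda>x. - w x) p" if "p \<in> ball x0 R" for p
    proof -
      have "super_at (\<lambda>_ _. 0) w p" using w U that mem_ball_imp_mem_cball unfolding pos_superharmonic_def by blast
      then show ?thesis by (simp add: super_at_iff_sub_at)
    qed
    show "- w y \<le> - w x0 + K * sqrt R" if "y \<in> sphere x0 R" for y
      using wp[of y] U that unfolding KR by (auto simp: less_imp_le)
    show "- (K ^ 3 / 16) * R powr (- 5 / 2) < 0" if "p \<in> ball x0 R" for p
      using K \<open>R > 0\<close> by simp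
    show "x \<in> cball x0 R" using x \<open>R > 0\<close> by auto
  qed (use K in simp)
  moreover have "K * sqrt (dist x x0) \<le> K * (sqrt R / 2)"
  proof -
    have "sqrt (dist x x0) \<le> sqrt (R / 4)" using x by (simp add: dist_commute)
    then show ?thesis using K by (simp add: real_sqrt_divide)
  qed
  ultimately show ?thesis using KR by simp
qed

lemma harnack_ball:
  assumes w: "pos_superharmonic U w" and U: "ball y e \<subseteq> U"
    and x: "x \<in> ball y (e / 10)" "x' \<in> ball y (e / 10)"
  shows "w x \<le> 2 * w x'"
proof (rule harnack_centre[OF w])
  have "dist y x < e / 10" using x(1) by simp
  then have e: "e > 0" using zero_le_dist[of y x] by linarith
  then show "0 < 4 / 5 * e" by simp
  show "cball x (4 / 5 * e) \<subseteq> U"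
  proof
    fix z assume "z \<in> cball x (4 / 5 * e)"
    then have "dist y z < e"
      using dist_triangle[of y z x] x(1) e by simp
    then show "z \<in> U" using U by auto
  qed
  show "x' \<in> cball x (4 / 5 * e / 4)"
    using dist_triangle[of x x' y] x by (simp add: dist_commute)
qed

text \<open>
Chains of small balls, in the form of an equivalence relation with open classes on a connected set. The
constant is chosen before the function.
\<close>
lemma harnack_connected:
  assumes "open U" "connected_component U x y"
  shows "\<exists>H. H > 0 \<and> (\<forall>w. pos_superharmonic U w \<longrightarrow> w x \<le> H * w y \<and> w y \<le> H * w x)"
proof -
  let ?R = "\<lambda>x y. \<exists>H. H > 0 \<and> (\<forall>w. pos_superharmonic U w \<longrightarrow> w x \<le> H * w y \<and> w y \<le> H * w x)"
  let ?S = "connected_component_set U x"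
  have S: "x \<in> ?S" "y \<in> ?S" "connected ?S"
    using assms by (auto simp: connected_component_refl_eq dest: connected_component_in)
  have "open ?S" using assms(1) by (rule open_connected_component)
  show ?thesis
  proof (rule connected_equivalence_relation[OF S(3,1,2), of ?R])
    fix a b assume "?R a b" then show "?R b a" by blast
  next
    fix a b c assume "?R a b" "?R b c"
    then obtain H H' where H: "H > 0" "H' > 0"
      "\<And>w. pos_superharmonic U w \<Longrightarrow> w a \<le> H * w b \<and> w b \<le> H * w a"
      "\<And>w. pos_superharmonic U w \<Longrightarrow> w b \<le> H' * w c \<and> w c \<le> H' * w b" by blast
    have "w a \<le> H * H' * w c \<and> w c \<le> H * H' * w a" if "pos_superharmonic U w" for w
    proof -
      have "w a \<le> H * (H' * w c)"
        using H(3,4)[OF that] H(1) by (meson less_imp_le mult_left_mono order_trans)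
      moreover have "w c \<le> H' * (H * w a)"
        using H(3,4)[OF that] H(2) by (meson less_imp_le mult_left_mono order_trans)
      ultimately show ?thesis by (simp add: ac_simps)
    qed
    then show "?R a c" using H(1,2) by (intro exI[of _ "H * H'"]) auto
  next
    fix a assume a: "a \<in> ?S"
    then have "a \<in> U" using connected_component_subset by blast
    then obtain e where e: "e > 0" "ball a e \<subseteq> U" using assms(1) open_contains_ball by blast
    let ?T = "?S \<inter> ball a (e / 10)"
    have "openin (top_of_set ?S) ?T" by (simp add: openin_open_Int)
    moreover have "a \<in> ?T" using a e by simp
    moreover have "?R a b" if "b \<in> ?T" for b
      using that e harnack_ball[OF _ e(2)] by (intro exI[of _ 2]) auto
    ultimately show "\<exists>T. openin (top_of_set ?S) T \<and> a \<in> T \<and> (\<forall>b\<in>T. ?R a b)" by blast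
  qed
qed

text \<open>
A finite cover of \<open>K\<close> by small Harnack balls leaves finitely many pairs of centres, so the constants of
\<open>harnack_connected\<close> for these pairs can be bounded together. No bound links different components of \<open>U\<close>.
\<close>
lemma harnack_compact:
  assumes "open U" "compact K" "K \<subseteq> U"
  obtains H where "H \<ge> 1"
    "\<And>w x y. pos_superharmonic U w \<Longrightarrow> x \<in> K \<Longrightarrow> y \<in> K \<Longrightarrow> connected_component U x y \<Longrightarrow> w x \<le> H * w y"
proof -
  have "\<forall>y\<in>K. \<exists>e. e > 0 \<and> ball y e \<subseteq> U"
    using assms(1,3) open_contains_ball by blast
  then obtain e where e: "\<And>y. y \<in> K \<Longrightarrow> e y > 0 \<and> ball y (e y) \<subseteq> U" by metis
  have "K \<subseteq> (\<Union>y\<in>K. ball y (e y / 10))" using e by force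
  then obtain Y where Y: "Y \<subseteq> K" "finite Y" "K \<subseteq> (\<Union>y\<in>Y. ball y (e y / 10))"
    using compactE_image[OF assms(2), of K "\<lambda>y. ball y (e y / 10)"] by (metis open_ball)
  have "\<exists>H. \<forall>y z. H y z > 0 \<and> (connected_component U y z \<longrightarrow> (\<forall>w. pos_superharmonic U w \<longrightarrow> w y \<le> H y z * w z))"
    using harnack_connected[OF assms(1)]
    by (intro choice allI) (metis zero_less_one)
  then obtain H where H: "\<And>y z. (H y z :: real) > 0"
    "\<And>y z w. connected_component U y z \<Longrightarrow> pos_superharmonic U w \<Longrightarrow> w y \<le> H y z * w z" by blast
  define M where "M = 1 + 4 * (\<Sum>(y,z)\<in>Y\<times>Y. H y z)"
  have sum: "H y z \<le> (\<Sum>(y,z)\<in>Y\<times>Y. H y z)" if "y \<in> Y" "z \<in> Y" for y z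
    using member_le_sum[of "(y,z)" "Y \<times> Y" "\<lambda>(y,z). H y z"] that Y(2) H(1) by (auto simp: less_imp_le)
  have sum0: "(\<Sum>(y,z)\<in>Y\<times>Y. H y z) \<ge> 0"
    using H(1) by (intro sum_nonneg) (auto simp: less_imp_le)
  show thesis
  proof (rule that[of M])
    show "M \<ge> 1" using sum0 by (simp add: M_def)
    fix w x x' assume w: "pos_superharmonic U w" and x: "x \<in> K" "x' \<in> K" "connected_component U x x'"
    obtain y where y: "y \<in> Y" "x \<in> ball y (e y / 10)" using Y(3) x(1) by blast
    obtain y' where y': "y' \<in> Y" "x' \<in> ball y' (e y' / 10)" using Y(3) x(2) by blast
    have ey: "e y > 0" "ball y (e y) \<subseteq> U" "e y' > 0" "ball y' (e y') \<subseteq> U"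
      using e y(1) y'(1) Y(1) by blast+
    have "connected_component U x y"
      using connected_componentI[of "ball y (e y)" U x y] ey y by force
    moreover have "connected_component U x' y'"
      using connected_componentI[of "ball y' (e y')" U x' y'] ey y' by force
    ultimately have c: "connected_component U y y'"
      using x(3) by (meson connected_component_sym connected_component_trans)
    have "w x \<le> 2 * w y" by (rule harnack_ball[OF w ey(2)]) (use y ey in auto)
    also have "\<dots> \<le> 2 * (H y y' * w y')" using H(2)[OF c w] by simp
    also have "\<dots> \<le> 2 * (H y y' * (2 * w x'))"
    proof -
      have "w y' \<le> 2 * w x'" by (rule harnack_ball[OF w ey(4)]) (use y' ey in auto)
      then show ?thesis using H(1) by (simp add: less_imp_le)
    qed
    also have "\<dots> = 4 * H y y' * w x'" by simp
    also have "\<dots> \<le> M * w x'"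
    proof (rule mult_right_mono)
      show "4 * H y y' \<le> M" using sum[OF y(1) y'(1)] by (simp add: M_def)
      have "x' \<in> U" using x(2) assms(3) by blast
      then show "0 \<le> w x'" using w by (simp add: pos_superharmonic_def less_imp_le)
    qed
    finally show "w x \<le> M * w x'" .
  qed
qed

section \<open>Finiteness of the first eigenvalue\<close>

text \<open>
Positive supersolutions of the eigenvalue equation on a set that is allowed to be closed, such as the
closure of a superlevel set inside a larger domain.
\<close>
definition pos_supersolution :: "('a::euclidean_space \<Rightarrow> real) \<Rightarrow> real \<Rightarrow> 'a set \<Rightarrow> ('a \<Rightarrow> real) \<Rightarrow> bool" where
  "pos_supersolution a \<mu> U w \<longleftrightarrow>
     continuous_on U w \<and> (\<forall>x\<in>U. 0 < w x \<and> super_at (\<lambda>x s. - \<mu> * a x * s ^ 3) w x)"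

lemma pos_supersolution_imp_pos_superharmonic:
  assumes "pos_supersolution a \<mu> U w" "\<mu> \<ge> 0" "\<And>x. x \<in> U \<Longrightarrow> a x > 0"
  shows "pos_superharmonic U w"
  unfolding pos_superharmonic_def
proof (intro conjI ballI)
  fix x assume x: "x \<in> U"
  have "super_at (\<lambda>x s. - \<mu> * a x * s ^ 3) w x" "0 < w x"
    using assms(1) x by (auto simp: pos_supersolution_def)
  then show "super_at (\<lambda>_ _. 0) w x" "0 < w x"
    using assms(2) assms(3)[OF x] by (auto elim!: super_at_mono simp: less_imp_le)
qed (use assms(1) in \<open>simp add: pos_supersolution_def\<close>)

text \<open>
The paraboloid \<open>- A |x - x\<^sub>0|\<^sup>2\<close> with \<open>A = w x\<^sub>0 / r\<^sup>2\<close> touches \<open>w\<close> from below inside the ball of radius \<open>r\<close>,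
since \<open>w > 0\<close> on the sphere. At the contact point its infinity-Laplacian is at least \<open>- 8 A\<^sup>3 r\<^sup>2\<close>,
while the equation and the Harnack inequality force a value of at most \<open>- \<mu> a (w x\<^sub>0 / 2)\<^sup>3\<close>. The size of
\<open>w\<close> cancels.
\<close>
lemma eigenvalue_bound:
  fixes a :: "'a::euclidean_space \<Rightarrow> real"
  assumes "open U" "U \<noteq> {}" and a: "continuous_on U a" "\<And>x. x \<in> U \<Longrightarrow> a x > 0"
  obtains B where "\<And>\<mu> w. \<mu> \<ge> 0 \<Longrightarrow> pos_supersolution a \<mu> U w \<Longrightarrow> \<mu> \<le> B"
proof -
  obtain x0 where x0: "x0 \<in> U" using assms(2) by blast
  then obtain R where R: "R > 0" "cball x0 R \<subseteq> U" using assms(1) open_contains_cball by blast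
  define r where "r = R / 4"
  have r: "r > 0" "cball x0 r \<subseteq> U" using R by (auto simp: r_def)
  obtain z where z: "z \<in> cball x0 r" "\<And>x. x \<in> cball x0 r \<Longrightarrow> a z \<le> a x"
    using continuous_attains_inf[of "cball x0 r" a] r continuous_on_subset[OF a(1) r(2)] by fastforce
  have az: "a z > 0" using z(1) r(2) a(2) by blast
  show thesis
  proof (rule that[of "64 / (a z * r ^ 4)"])
    fix \<mu> w
    assume \<mu>: "\<mu> \<ge> 0" and pw: "pos_supersolution a \<mu> U w"
    then have w: "continuous_on U w" "\<And>x. x \<in> U \<Longrightarrow> w x > 0"
      "\<And>x. x \<in> U \<Longrightarrow> super_at (\<lambda>x s. - \<mu> * a x * s ^ 3) w x"
      by (auto simp: pos_supersolution_def)
    have "pos_superharmonic U w"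
      by (rule pos_supersolution_imp_pos_superharmonic[OF pw \<mu> a(2)])
    from harnack_centre[OF this R] have har: "w x0 \<le> 2 * w x" if "x \<in> cball x0 r" for x
      using that by (simp add: r_def)
    define A where "A = w x0 / r\<^sup>2"
    have A: "A > 0" "A * r\<^sup>2 = w x0" using w(2)[OF x0] r by (auto simp: A_def)
    define f where "f x = w x + A * (dist x x0)\<^sup>2" for x
    have "continuous_on (cball x0 r) f"
      unfolding f_def[abs_def] by (intro continuous_intros continuous_on_subset[OF w(1) r(2)])
    then obtain p where p: "p \<in> cball x0 r" "\<And>x. x \<in> cball x0 r \<Longrightarrow> f p \<le> f x"
      using continuous_attains_inf[of "cball x0 r" f] r by fastforce
    have pU: "p \<in> U" using p(1) r(2) by blast
    have "f p \<le> w x0" using p(2)[of x0] r by (simp add: f_def)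
    then have "A * (dist p x0)\<^sup>2 < A * r\<^sup>2" using w(2)[OF pU] unfolding A(2) by (simp add: f_def)
    then have "(dist p x0)\<^sup>2 < r\<^sup>2" using A(1) by simp
    then have pr: "dist p x0 < r" using r by (simp add: power2_less_imp_less)
    then have pb: "p \<in> ball x0 r" by (simp add: dist_commute)
    have L: "linear (\<lambda>z::'a. (- 2 * A) *\<^sub>R z)" by (rule linear_scaleR)
    have "\<forall>\<^sub>F x in nhds p. - f x \<le> - f p"
      by (rule local_max_interior[OF pb]) (use p(2) in auto)
    then have "\<forall>\<^sub>F x in nhds p. w p + quad ((- 2 * A) *\<^sub>R (p - x0)) (\<lambda>z. (- 2 * A) *\<^sub>R z) (x - p) \<le> w x"
    proof eventually_elim
      case (elim x)
      have "(dist x x0)\<^sup>2 = (dist p x0)\<^sup>2 + 2 * ((p - x0) \<bullet> (x - p)) + (x - p) \<bullet> (x - p)"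
        by (simp add: dist_norm power2_norm_eq_inner algebra_simps inner_commute)
      then have "A * (dist x x0)\<^sup>2 = A * (dist p x0)\<^sup>2 + 2 * A * ((p - x0) \<bullet> (x - p)) + A * ((x - p) \<bullet> (x - p))"
        by (simp add: ring_distribs)
      with elim show ?case by (simp add: f_def quad_def)
    qed
    from w(3)[OF pU, unfolded super_at_def, rule_format, OF L this]
    have "\<mu> * a p * w p ^ 3 \<le> 8 * A ^ 3 * (dist p x0)\<^sup>2"
      by (simp add: power3_eq_cube dist_norm power2_norm_eq_inner)
    also have "\<dots> \<le> 8 * A ^ 3 * r\<^sup>2"
      using \<open>(dist p x0)\<^sup>2 < r\<^sup>2\<close> A(1) by (intro mult_left_mono) auto
    finally have up: "\<mu> * a p * w p ^ 3 \<le> 8 * A ^ 3 * r\<^sup>2" .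
    have "\<mu> * a z * (w x0 / 2) ^ 3 \<le> \<mu> * a p * w p ^ 3"
    proof (intro mult_mono power_mono)
      show "\<mu> \<le> \<mu>" "a z \<le> a p" using z(2) p(1) by auto
      show "w x0 / 2 \<le> w p" using har[OF p(1)] by simp
    qed (use \<mu> az w(2)[OF x0] a(2)[OF pU] in \<open>auto simp: less_imp_le\<close>)
    with up have "\<mu> * a z * (w x0 / 2) ^ 3 \<le> 8 * A ^ 3 * r\<^sup>2" by simp
    also have "8 * A ^ 3 * r\<^sup>2 = 64 / r ^ 4 * (w x0 / 2) ^ 3"
      using r by (simp add: A_def power_divide field_simps eval_nat_numeral)
    finally have "\<mu> * a z \<le> 64 / r ^ 4"
      using w(2)[OF x0] by (simp only: mult_le_cancel_right) (auto simp: zero_less_power)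
    then show "\<mu> \<le> 64 / (a z * r ^ 4)"
      using az r by (simp add: field_simps)
  qed
qed

section \<open>Perron's method\<close>

lemma isCont_tendsto_nhds: "isCont f p \<Longrightarrow> (f \<longlongrightarrow> f p) (nhds p)"
  unfolding isCont_def tendsto_at_iff_tendsto_nhds .

text \<open>
A strict inequality between continuous quantities at \<open>(p, s\<^sub>0)\<close> holds on a product neighbourhood.
\<close>
lemma eventually_pos_uniformly:
  fixes h :: "'a::t2_space \<Rightarrow> real \<Rightarrow> real"
  assumes U: "open U" "p \<in> U" and h: "continuous_on (U \<times> UNIV) (\<lambda>(x, s). h x s)" and "0 < h p s0"
  obtains \<eta> where "\<eta> > 0" "\<forall>\<^sub>F x in nhds p. \<forall>s. \<bar>s - s0\<bar> < \<eta> \<longrightarrow> 0 < h x s"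
proof -
  have "isCont (\<lambda>(x, s). h x s) (p, s0)"
    using h U by (simp add: continuous_on_eq_continuous_at open_Times)
  then have "((\<lambda>(x, s). h x s) \<longlongrightarrow> h p s0) (nhds (p, s0))"
    using isCont_tendsto_nhds by fastforce
  from order_tendstoD(1)[OF this \<open>0 < h p s0\<close>]
  obtain P Q where PQ: "eventually P (nhds p)" "eventually Q (nhds s0)"
    "\<And>x s. P x \<Longrightarrow> Q s \<Longrightarrow> 0 < h x s"
    unfolding nhds_prod eventually_prod_filter by auto
  obtain \<eta> where "\<eta> > 0" "\<And>s. dist s s0 < \<eta> \<Longrightarrow> Q s"
    using PQ(2) unfolding eventually_nhds_metric by blast
  then show thesis
    using that[of \<eta>] PQ(1,3) by (simp add: dist_real_def eventually_mono)
qed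

lemma less_add_small:
  fixes a b c :: real
  assumes "a < c"
  obtains \<gamma> where "\<gamma> > 0" "a + \<gamma> * b < c"
proof
  let ?\<gamma> = "(c - a) / (2 * (1 + \<bar>b\<bar>))"
  show g: "?\<gamma> > 0" using assms by (simp add: add_pos_nonneg)
  have "?\<gamma> * b \<le> ?\<gamma> * (1 + \<bar>b\<bar>)" using g by (intro mult_left_mono) auto
  also have "\<dots> = (c - a) / 2" by (simp add: field_simps add_pos_nonneg)
  finally show "a + ?\<gamma> * b < c" using assms by argo
qed

definition quad_inf_laplacian :: "'a::euclidean_space \<Rightarrow> ('a \<Rightarrow> 'a) \<Rightarrow> 'a \<Rightarrow> real" where
  "quad_inf_laplacian q L z = quad_grad q L z \<bullet> L (quad_grad q L z)"

lemma continuous_on_quad_inf_laplacian: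
  "linear L \<Longrightarrow> continuous_on S (\<lambda>x. quad_inf_laplacian q L (x - p))"
  unfolding quad_inf_laplacian_def
  by (intro continuous_intros continuous_on_quad_grad linear_continuous_on_compose[of _ _ L])

lemma tendsto_quad: "linear L \<Longrightarrow> ((\<lambda>x. quad q L (x - p)) \<longlongrightarrow> 0) (nhds p)"
  using continuous_on_quad[of L UNIV q p] isCont_tendsto_nhds[of p "\<lambda>x. quad q L (x - p)"]
  by (simp add: continuous_on_eq_continuous_at)

text \<open>
The supremum of subsolutions is a subsolution. A polynomial touching \<open>w\<close> at \<open>p\<close> that violated the inequality
would, made strict by \<open>\<gamma> |x - p|\<^sup>2\<close>, touch some competitor \<open>v\<close> with \<open>v p\<close> close to \<open>w p\<close> at a nearby point
and violate the inequality for \<open>v\<close>.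
\<close>
lemma sub_at_Sup:
  fixes w :: "'a::euclidean_space \<Rightarrow> real"
  assumes U: "open U" "p \<in> U" and F: "continuous_on (U \<times> UNIV) (\<lambda>(x, s). F x s)"
    and w: "continuous_on U w"
    and approx: "\<And>\<epsilon>. \<epsilon> > 0 \<Longrightarrow> \<exists>v. continuous_on U v \<and>
      (\<forall>x\<in>U. sub_at F v x \<and> v x \<le> w x) \<and> w p - \<epsilon> < v p"
  shows "sub_at F w p"
  unfolding sub_at_def
proof (intro allI impI, rule ccontr)
  fix q L assume L: "linear L" and touch: "\<forall>\<^sub>F x in nhds p. w x \<le> w p + quad q L (x - p)"
    and neg: "\<not> F p (w p) \<le> q \<bullet> L q"
  then obtain \<gamma> where \<gamma>: "\<gamma> > 0" "q \<bullet> L q + \<gamma> * (2 * (norm q)\<^sup>2) < F p (w p)"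
    using less_add_small[of "q \<bullet> L q" "F p (w p)"] by (auto simp: not_le)
  \<comment> \<open>The polynomial is made strict while its infinity-Laplacian at \<open>p\<close> stays below \<open>F p (w p)\<close>.\<close>
  define M where "M x = L x + (2 * \<gamma>) *\<^sub>R x" for x
  have M: "linear M" unfolding M_def[abs_def] by (rule linear_add_scaleR[OF L])
  have quadM: "quad q M z = quad q L z + \<gamma> * (norm z)\<^sup>2" for z
    unfolding M_def[abs_def] by (simp add: quad_add_square)
  have "quad_inf_laplacian q M (p - p) = q \<bullet> L q + \<gamma> * (2 * (norm q)\<^sup>2)"
    by (simp add: quad_inf_laplacian_def M) (simp add: M_def inner_add_right power2_norm_eq_inner)
  then have strict: "0 < F p (w p) - quad_inf_laplacian q M (p - p)" using \<gamma>(2) by simp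
  have "continuous_on (U \<times> UNIV) (\<lambda>(x, s). F x s - quad_inf_laplacian q M (x - p))"
    using continuous_on_diff[OF F continuous_on_compose2[OF continuous_on_quad_inf_laplacian[OF M]
          continuous_on_fst[OF continuous_on_id] subset_UNIV]]
    by (simp add: case_prod_unfold)
  from eventually_pos_uniformly[OF U this strict]
  obtain \<eta> where \<eta>: "\<eta> > 0" and viol: "\<forall>\<^sub>F x in nhds p. \<forall>s. \<bar>s - w p\<bar> < \<eta> \<longrightarrow> quad_inf_laplacian q M (x - p) < F x s"
    by auto
  have tendw: "(w \<longlongrightarrow> w p) (nhds p)"
    using w U by (simp add: continuous_on_eq_continuous_at isCont_tendsto_nhds)
  have "\<forall>\<^sub>F x in nhds p. (\<forall>s. \<bar>s - w p\<bar> < \<eta> \<longrightarrow> quad_inf_laplacian q M (x - p) < F x s) \<and> x \<in> U \<and> w x < w p + \<eta> \<and> - (\<eta> / 2) < quad q M (x - p)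
      \<and> w x \<le> w p + quad q L (x - p)"
    using viol eventually_nhds_in_open[OF U] touch order_tendstoD(2)[OF tendw, of "w p + \<eta>"]
      order_tendstoD(1)[OF tendsto_quad[OF M], of "- (\<eta> / 2)"] \<eta>
    by (simp add: eventually_conj_iff)
  then obtain r where r: "r > 0"
    and near: "\<And>x. dist x p \<le> r \<Longrightarrow> (\<forall>s. \<bar>s - w p\<bar> < \<eta> \<longrightarrow> quad_inf_laplacian q M (x - p) < F x s) \<and> x \<in> U \<and> w x < w p + \<eta> \<and> - (\<eta> / 2) < quad q M (x - p)
      \<and> w x \<le> w p + quad q L (x - p)"
    unfolding eventually_nhds_metric_le by blast
  have sub: "cball p r \<subseteq> U" using near by (auto simp: dist_commute)
  obtain v where v: "continuous_on U v" "\<And>x. x \<in> U \<Longrightarrow> sub_at F v x \<and> v x \<le> w x"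
    "w p - min (\<gamma> * r\<^sup>2) (\<eta> / 2) < v p"
    using approx[of "min (\<gamma> * r\<^sup>2) (\<eta> / 2)"] \<gamma>(1) r \<eta> by auto
  define f where "f x = v x - quad q M (x - p)" for x
  have "continuous_on (cball p r) f"
    unfolding f_def[abs_def]
    by (intro continuous_intros continuous_on_quad M continuous_on_subset[OF v(1) sub])
  then obtain p' where p': "p' \<in> cball p r" "\<And>x. x \<in> cball p r \<Longrightarrow> f x \<le> f p'"
    using continuous_attains_sup[of "cball p r" f] r by fastforce
  have near': "\<forall>s. \<bar>s - w p\<bar> < \<eta> \<longrightarrow> quad_inf_laplacian q M (p' - p) < F p' s" "p' \<in> U" "w p' < w p + \<eta>" "- (\<eta> / 2) < quad q M (p' - p)"
    "w p' \<le> w p + quad q L (p' - p)" using near[of p'] p'(1) by (auto simp: dist_commute)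
  have fp': "f p' \<ge> v p" using p'(2)[of p] r M by (simp add: f_def)
  have "dist p p' \<noteq> r"
  proof
    assume "dist p p' = r"
    then have "quad q M (p' - p) = quad q L (p' - p) + \<gamma> * r\<^sup>2"
      by (simp add: quadM dist_norm norm_minus_commute)
    then have "f p' \<le> w p - \<gamma> * r\<^sup>2"
      using v(2)[OF near'(2)] near'(5) by (simp add: f_def)
    then show False using fp' v(3) by simp
  qed
  with p'(1) have p'b: "p' \<in> ball p r" by simp
  have local_max: "\<forall>\<^sub>F x in nhds p'. f x \<le> f p'"
    by (rule local_max_interior[OF p'b]) (rule p'(2))
  have "\<forall>\<^sub>F x in nhds p'. v x \<le> v p' + quad (quad_grad q M (p' - p)) M (x - p')"
    using local_max
  proof eventually_elim
    case (elim x)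
    then show ?case
      using quad_add[OF M, of q "p' - p" "x - p'"] by (simp add: f_def)
  qed
  then have "F p' (v p') \<le> quad_inf_laplacian q M (p' - p)"
    using v(2)[OF near'(2)] M unfolding sub_at_def quad_inf_laplacian_def by blast
  moreover have "\<bar>v p' - w p\<bar> < \<eta>"
    using v(2)[OF near'(2)] near'(3,4) fp' v(3) min.cobounded2[of "\<gamma> * r\<^sup>2" "\<eta> / 2"]
    unfolding f_def abs_less_iff by linarith
  ultimately show False using near'(1) by force
qed

text \<open>
Perron's bump. Where the supersolution property fails, the offending test polynomial, made strict by
\<open>- \<gamma> |x - p|\<^sup>2\<close>, is a strict subsolution near \<open>p\<close>. Lifted by \<open>\<kappa>\<close> it exceeds \<open>w\<close> at \<open>p\<close> but stays below \<open>w\<close>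
on a small sphere, so the maximum of the two inside that sphere is a larger subsolution. The
strict inequality \<open>w p < G p\<close> leaves room for the lift.
\<close>
lemma bump:
  fixes w :: "'a::euclidean_space \<Rightarrow> real"
  assumes U: "open U" "p \<in> U" and F: "continuous_on (U \<times> UNIV) (\<lambda>(x, s). F x s)"
    and w: "continuous_on U w" "\<And>x. x \<in> U \<Longrightarrow> sub_at F w x"
    and G: "continuous_on U G" "w p < G p" and nsuper: "\<not> super_at F w p"
  obtains V where "continuous_on U V" "\<And>x. x \<in> U \<Longrightarrow> sub_at F V x"
    "\<And>x. w x \<le> V x" "\<And>x. V x \<le> max (w x) (G x)" "w p < V p"
proof -
  obtain q L where L: "linear L" and touch: "\<forall>\<^sub>F x in nhds p. w p + quad q L (x - p) \<le> w x"
    and neg: "F p (w p) < q \<bullet> L q"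
    using nsuper unfolding super_at_def by (auto simp: not_le)
  obtain \<gamma> where \<gamma>: "\<gamma> > 0" "F p (w p) + \<gamma> * (2 * (norm q)\<^sup>2) < q \<bullet> L q"
    by (rule less_add_small[OF neg])
  define M where "M x = L x + (- 2 * \<gamma>) *\<^sub>R x" for x
  have M: "linear M" unfolding M_def[abs_def] by (rule linear_add_scaleR[OF L])
  have quadM: "quad q M z = quad q L z - \<gamma> * (norm z)\<^sup>2" for z
    unfolding M_def[abs_def] by (simp only: quad_add_square)
  have "quad_inf_laplacian q M (p - p) = q \<bullet> L q - \<gamma> * (2 * (norm q)\<^sup>2)"
    by (simp add: quad_inf_laplacian_def M) (simp add: M_def inner_diff_right power2_norm_eq_inner)
  then have strict: "0 < quad_inf_laplacian q M (p - p) - F p (w p)" using \<gamma>(2) by simp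
  have "continuous_on (U \<times> UNIV) (\<lambda>(x, s). quad_inf_laplacian q M (x - p) - F x s)"
    using continuous_on_diff[OF continuous_on_compose2[OF continuous_on_quad_inf_laplacian[OF M]
          continuous_on_fst[OF continuous_on_id] subset_UNIV] F]
    by (simp add: case_prod_unfold)
  from eventually_pos_uniformly[OF U this strict]
  obtain \<eta> where \<eta>: "\<eta> > 0" and viol: "\<forall>\<^sub>F x in nhds p. \<forall>s. \<bar>s - w p\<bar> < \<eta> \<longrightarrow> F x s < quad_inf_laplacian q M (x - p)"
    by auto
  define \<kappa>0 where "\<kappa>0 = min (\<eta> / 2) ((G p - w p) / 3)"
  have \<kappa>0: "\<kappa>0 > 0" "\<kappa>0 \<le> \<eta> / 2" "3 * \<kappa>0 \<le> G p - w p"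
    using \<eta> G(2) min.cobounded2[of "\<eta> / 2" "(G p - w p) / 3"] by (auto simp: \<kappa>0_def)
  have tendG: "(G \<longlongrightarrow> G p) (nhds p)"
    using G U by (simp add: continuous_on_eq_continuous_at isCont_tendsto_nhds)
  have "\<forall>\<^sub>F x in nhds p. (\<forall>s. \<bar>s - w p\<bar> < \<eta> \<longrightarrow> F x s < quad_inf_laplacian q M (x - p)) \<and> x \<in> U \<and> G p - \<kappa>0 < G x \<and> - \<kappa>0 < quad q M (x - p)
      \<and> quad q M (x - p) < \<kappa>0 \<and> w p + quad q L (x - p) \<le> w x"
    using viol eventually_nhds_in_open[OF U] touch order_tendstoD(1)[OF tendG, of "G p - \<kappa>0"]
      order_tendstoD(1)[OF tendsto_quad[OF M], of "- \<kappa>0"] order_tendstoD(2)[OF tendsto_quad[OF M], of \<kappa>0] \<kappa>0(1)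
    by (simp add: eventually_conj_iff)
  then obtain r where r: "r > 0"
    and near: "\<And>x. dist x p \<le> r \<Longrightarrow> (\<forall>s. \<bar>s - w p\<bar> < \<eta> \<longrightarrow> F x s < quad_inf_laplacian q M (x - p)) \<and> x \<in> U \<and> G p - \<kappa>0 < G x \<and> - \<kappa>0 < quad q M (x - p)
      \<and> quad q M (x - p) < \<kappa>0 \<and> w p + quad q L (x - p) \<le> w x"
    unfolding eventually_nhds_metric_le by blast
  have sub: "cball p r \<subseteq> U" using near by (auto simp: dist_commute)
  define \<kappa> where "\<kappa> = min \<kappa>0 (\<gamma> * r\<^sup>2 / 2)"
  have \<kappa>: "\<kappa> > 0" "\<kappa> \<le> \<kappa>0" "\<kappa> < \<gamma> * r\<^sup>2" using \<kappa>0 \<gamma>(1) r by (auto simp: \<kappa>_def min_less_iff_disj zero_less_power)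
  define B where "B x = w p + quad q M (x - p) + \<kappa>" for x
  define V where "V x = (if x \<in> ball p r then max (w x) (B x) else w x)" for x
  have B_sphere: "B x < w x" if "dist p x = r" for x
  proof -
    have "quad q M (x - p) = quad q L (x - p) - \<gamma> * r\<^sup>2"
      using that by (simp add: quadM dist_norm norm_minus_commute)
    then show ?thesis using near[of x] that \<kappa>(3) by (simp add: B_def dist_commute)
  qed
  have contB: "continuous_on S B" for S
    unfolding B_def[abs_def] by (intro continuous_intros continuous_on_quad M)
  have sub_B: "sub_at F B x" if "x \<in> ball p r" for x
    unfolding sub_at_def
  proof (intro allI impI)
    fix q2 L2 assume L2: "linear L2" and ev: "\<forall>\<^sub>F y in nhds x. B y \<le> B x + quad q2 L2 (y - x)"
    have "\<forall>\<^sub>F y in nhds x. quad (quad_grad q M (x - p)) M (y - x) \<le> quad q2 L2 (y - x)"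
      using ev
    proof eventually_elim
      case (elim y)
      then show ?case
        using quad_add[OF M, of q "x - p" "y - x"] by (simp add: B_def)
    qed
    from quad_order(2)[OF L2 M this] have "quad_inf_laplacian q M (x - p) \<le> q2 \<bullet> L2 q2" by (simp add: quad_inf_laplacian_def)
    moreover have nx: "\<forall>s. \<bar>s - w p\<bar> < \<eta> \<longrightarrow> F x s < quad_inf_laplacian q M (x - p)" "- \<kappa>0 < quad q M (x - p)" "quad q M (x - p) < \<kappa>0"
      using near[of x] that by (auto simp: dist_commute)
    moreover have "\<bar>B x - w p\<bar> < \<eta>"
      using nx(2,3) \<kappa>0 \<kappa> by (simp add: B_def abs_if)
    ultimately show "F x (B x) \<le> q2 \<bullet> L2 q2" by force
  qed
  show thesis
  proof
    have "continuous_on (cball p r \<union> (U - ball p r)) (\<lambda>x. if x \<in> ball p r then max (w x) (B x) else w x)"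
    proof (rule continuous_on_cases_local)
      \<comment> \<open>The two pieces overlap in the sphere only, where the polynomial lies below \<open>w\<close>.\<close>
      have un: "cball p r \<union> (U - ball p r) = U" using sub by auto
      show "closedin (top_of_set (cball p r \<union> (U - ball p r))) (cball p r)"
        unfolding un by (simp add: closed_subset sub)
      show "closedin (top_of_set (cball p r \<union> (U - ball p r))) (U - ball p r)"
        unfolding un by (simp add: Diff_eq closedin_closed_Int closed_Compl)
      show "continuous_on (cball p r) (\<lambda>x. max (w x) (B x))"
        by (intro continuous_intros contB continuous_on_subset[OF w(1) sub])
      show "continuous_on (U - ball p r) w" by (rule continuous_on_subset[OF w(1)]) auto
    qed (use B_sphere in \<open>force simp: max_def\<close>)
    moreover have "cball p r \<union> (U - ball p r) = U" using sub by auto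
    ultimately show "continuous_on U V" by (simp add: V_def[abs_def])
    show "w x \<le> V x" for x by (simp add: V_def)
    show "V x \<le> max (w x) (G x)" for x
      using near[of x] \<kappa> \<kappa>0 by (auto simp: V_def B_def dist_commute max_def)
    show "w p < V p" using r \<kappa>(1) M by (simp add: V_def B_def)
    show "sub_at F V x" if x: "x \<in> U" for x
    proof (cases "V x = w x")
      case True
      then show ?thesis
        by (rule sub_at_touching[OF w(2)[OF x]]) (simp add: V_def)
    next
      case False
      then have xb: "x \<in> ball p r" and "V x = B x" by (auto simp: V_def max_def split: if_splits)
      then show ?thesis
        by (intro sub_at_touching[OF sub_B[OF xb]])
          (auto intro: eventually_mono[OF eventually_nhds_in_open[OF open_ball xb]] simp: V_def)
    qed
  qed
qed

definition perron_family ::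
  "'a::euclidean_space set \<Rightarrow> ('a \<Rightarrow> real \<Rightarrow> real) \<Rightarrow> ('a \<Rightarrow> real) \<Rightarrow> ('a \<Rightarrow> real) \<Rightarrow> ('a \<Rightarrow> real) set" where
  "perron_family U F v0 G =
     {v. continuous_on U v \<and> (\<forall>x\<in>U. sub_at F v x \<and> v0 x \<le> v x \<and> v x \<le> G x)}"

text \<open>
The family is bounded on compact sets by \<open>v0\<close> and \<open>G\<close>, hence so is \<open>F x (v x)\<close>, and one constant \<open>K\<close>
works in the comparison with \<open>K \<surd>|x - y|\<close> for all members and all nearby centres.
\<close>
lemma perron_family_equicontinuous:
  fixes U :: "'a::euclidean_space set"
  assumes U: "open U" "p \<in> U" and F: "continuous_on (U \<times> UNIV) (\<lambda>(x, s). F x s)"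
    and v0: "continuous_on U v0" and G: "continuous_on U G"
  obtains R K where "R > 0" "cball p R \<subseteq> U"
    "\<And>v x y. v \<in> perron_family U F v0 G \<Longrightarrow> x \<in> cball p R \<Longrightarrow> y \<in> cball p R \<Longrightarrow>
      v y \<le> v x + K * sqrt (dist y x)"
proof -
  obtain R3 where R3: "R3 > 0" "cball p R3 \<subseteq> U" using U open_contains_cball by blast
  define R where "R = R3 / 3"
  have R: "R > 0" "cball p (3 * R) \<subseteq> U" using R3 by (auto simp: R_def)
  let ?C = "cball p (3 * R)"
  have "compact (v0 ` ?C)" "compact (G ` ?C)"
    using R by (auto intro!: compact_continuous_image intro: continuous_on_subset[OF v0] continuous_on_subset[OF G])
  then have "bounded (v0 ` ?C \<union> G ` ?C)" by (simp add: compact_imp_bounded)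
  then obtain B where B: "\<And>x. x \<in> ?C \<Longrightarrow> \<bar>v0 x\<bar> \<le> B \<and> \<bar>G x\<bar> \<le> B"
    unfolding bounded_iff by (metis UnCI imageI real_norm_def)
  have "compact ((\<lambda>(x, s). F x s) ` (?C \<times> {-B..B}))"
    using R by (intro compact_continuous_image compact_Times continuous_on_subset[OF F]) auto
  then obtain N where N: "N > 0" "\<And>x s. x \<in> ?C \<Longrightarrow> s \<in> {-B..B} \<Longrightarrow> \<bar>F x s\<bar> \<le> N"
    using compact_imp_bounded[of "(\<lambda>(x, s). F x s) ` (?C \<times> {-B..B})"] unfolding bounded_pos by force
  have "p \<in> ?C" using R by simp
  then have B0: "B \<ge> 0" using B abs_ge_zero order_trans by blast
  \<comment> \<open>The last two summands make \<open>K\<close> dominate the oscillation \<open>2 B\<close> on the sphere and the bound \<open>N\<close> on the right-hand side.\<close>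
  define K where "K = 1 + 2 * B / sqrt (2 * R) + 16 * N * (2 * R) powr (5 / 2)"
  have K1: "K \<ge> 1" using B0 N R by (simp add: K_def)
  have KB: "2 * B \<le> K * sqrt (2 * R)"
  proof -
    have "2 * B = 2 * B / sqrt (2 * R) * sqrt (2 * R)" using R by simp
    also have "\<dots> \<le> K * sqrt (2 * R)"
      using N R by (intro mult_right_mono) (auto simp: K_def)
    finally show ?thesis .
  qed
  have KN: "- (K ^ 3 / 16) * (2 * R) powr (- 5 / 2) < - N"
  proof -
    have "16 * N * (2 * R) powr (5 / 2) < K" using B0 R by (simp add: K_def add_pos_nonneg)
    also have "K \<le> K ^ 3" using K1 by (simp add: self_le_power)
    finally have "16 * N * (2 * R) powr (5 / 2) < K ^ 3" .
    then have "16 * N * (2 * R) powr (5 / 2) * (2 * R) powr (- 5 / 2) < K ^ 3 * (2 * R) powr (- 5 / 2)"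
      using R by (intro mult_strict_right_mono) auto
    moreover have "(2 * R) powr (5 / 2) * (2 * R) powr (- 5 / 2) = 1"
      using R by (simp add: powr_add[symmetric])
    ultimately show ?thesis by (simp add: mult.assoc)
  qed
  show thesis
  proof (rule that[of R K])
    show "R > 0" "cball p R \<subseteq> U" using R by auto
    fix v x y
    assume vF: "v \<in> perron_family U F v0 G" and xy: "x \<in> cball p R" "y \<in> cball p R"
    have v: "continuous_on U v" "\<And>x. x \<in> U \<Longrightarrow> sub_at F v x \<and> v0 x \<le> v x \<and> v x \<le> G x"
      using vF by (simp_all add: perron_family_def)
    have sub: "cball x (2 * R) \<subseteq> ?C"
    proof
      fix z assume "z \<in> cball x (2 * R)"
      then show "z \<in> ?C" using dist_triangle[of p z x] xy(1) by simp
    qed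
    have bd: "\<bar>v z\<bar> \<le> B" if "z \<in> ?C" for z
      using B[OF that] v(2)[OF subsetD[OF R(2) that]] by linarith
    show "v y \<le> v x + K * sqrt (dist y x)"
    proof (rule sub_at_hoelder[of x "2 * R"])
      show "continuous_on (cball x (2 * R)) v"
        using v(1) sub R(2) by (meson continuous_on_subset order_trans)
      fix z assume "z \<in> ball x (2 * R)"
      then have z: "z \<in> ?C" using sub mem_ball_imp_mem_cball by blast
      then show "sub_at F v z" using v(2) R(2) by blast
      have "- N \<le> F z (v z)" using N(2)[OF z, of "v z"] bd[OF z] by (auto simp: abs_le_iff)
      then show "- (K ^ 3 / 16) * (2 * R) powr (- 5 / 2) < F z (v z)" using KN by linarith
    next
      fix z assume "z \<in> sphere x (2 * R)"
      then have "z \<in> ?C" "x \<in> ?C" using subsetD[OF sub] R(1) by auto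
      then show "v z \<le> v x + K * sqrt (2 * R)" using bd[of z] bd[of x] KB by linarith
    next
      show "y \<in> cball x (2 * R)" using dist_triangle[of x y p] xy by (simp add: dist_commute)
    qed (use K1 in simp)
  qed
qed

text \<open>
At a point where \<open>w\<close> meets \<open>G\<close> the supersolution property is inherited from \<open>G\<close>; elsewhere a failure would
allow a bump inside the family. At the boundary \<open>w\<close> is squeezed between \<open>v0\<close> and \<open>G\<close>.
\<close>
theorem perron:
  fixes U :: "'a::euclidean_space set"
  assumes U: "open U" and F: "continuous_on (U \<times> UNIV) (\<lambda>(x, s). F x s)"
    and v0: "continuous_on (closure U) v0" "\<And>x. x \<in> U \<Longrightarrow> sub_at F v0 x"
    and G: "continuous_on (closure U) G" "\<And>x. x \<in> U \<Longrightarrow> super_at F G x"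
    and le: "\<And>x. x \<in> U \<Longrightarrow> v0 x \<le> G x" and bdry: "\<And>x. x \<in> frontier U \<Longrightarrow> v0 x = G x"
  obtains w where "continuous_on (closure U) w"
    "\<And>x. x \<in> U \<Longrightarrow> v0 x \<le> w x \<and> w x \<le> G x" "\<And>x. x \<in> frontier U \<Longrightarrow> w x = v0 x"
    "\<And>x. x \<in> U \<Longrightarrow> sub_at F w x \<and> super_at F w x"
proof -
  define \<F> where "\<F> = perron_family U F v0 G"
  note \<F>_def = this[unfolded perron_family_def]
  \<comment> \<open>Outside \<open>U\<close> the members of the family are arbitrary, so the boundary values are prescribed.\<close>
  define w where "w x = (if x \<in> U then SUP v\<in>\<F>. v x else v0 x)" for x
  have v0U: "continuous_on U v0" and GU: "continuous_on U G"
    using v0(1) G(1) closure_subset continuous_on_subset by blast+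
  have v0F: "v0 \<in> \<F>" using v0(2) v0U le by (simp add: \<F>_def)
  have upper: "v x \<le> w x" if "v \<in> \<F>" "x \<in> U" for v x
    using that unfolding w_def
    by (auto intro!: cSUP_upper bdd_aboveI2[of _ _ "G x"] simp: \<F>_def)
  have least: "w x \<le> b" if "x \<in> U" "\<And>v. v \<in> \<F> \<Longrightarrow> v x \<le> b" for x b
    using that v0F unfolding w_def by (auto intro: cSUP_least)
  have between: "v0 x \<le> w x \<and> w x \<le> G x" if "x \<in> U" for x
    using upper[OF v0F that] least[OF that, of "G x"] that by (auto simp: \<F>_def)
  have contw: "isCont w p" if p: "p \<in> U" for p
  proof -
    obtain R K where RK: "R > 0" "cball p R \<subseteq> U"
      "\<And>v x y. v \<in> \<F> \<Longrightarrow> x \<in> cball p R \<Longrightarrow> y \<in> cball p R \<Longrightarrow> v y \<le> v x + K * sqrt (dist y x)"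
      unfolding \<open>\<F> = perron_family U F v0 G\<close>
      using perron_family_equicontinuous[OF U p F v0U GU] by blast
    have osc: "w y \<le> w x + K * sqrt (dist y x)" if "x \<in> cball p R" "y \<in> cball p R" for x y
    proof (rule least)
      show "y \<in> U" using that RK(2) by blast
      fix v assume v: "v \<in> \<F>"
      have "v x \<le> w x" using upper[OF v] that RK(2) by blast
      then show "v y \<le> w x + K * sqrt (dist y x)" using RK(3)[OF v that] by linarith
    qed
    have "\<forall>\<^sub>F x in at p. norm (w x - w p) \<le> K * sqrt (dist x p)"
      unfolding eventually_at
    proof (intro exI[of _ R] conjI ballI impI)
      fix x assume "x \<noteq> p \<and> dist x p < R"
      then have "x \<in> cball p R" "p \<in> cball p R" using RK(1) by (auto simp: dist_commute)
      then show "norm (w x - w p) \<le> K * sqrt (dist x p)"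
        using osc[of x p] osc[of p x] by (simp add: dist_commute abs_le_iff)
    qed (rule RK)
    moreover have "((\<lambda>x. K * sqrt (dist x p)) \<longlongrightarrow> K * sqrt (dist p p)) (at p)"
      by (intro tendsto_intros)
    ultimately have "((\<lambda>x. w x - w p) \<longlongrightarrow> 0) (at p)"
      by (intro Lim_null_comparison[of "\<lambda>x. w x - w p" "\<lambda>x. K * sqrt (dist x p)"]) auto
    then show ?thesis by (simp add: isCont_def LIM_zero_iff)
  qed
  have wU: "continuous_on U w" using contw by (simp add: continuous_at_imp_continuous_on)
  have subw: "sub_at F w x" if x: "x \<in> U" for x
  proof (rule sub_at_Sup[OF U x F wU])
    fix \<epsilon> :: real assume "\<epsilon> > 0"
    then have "\<not> w x \<le> w x - \<epsilon>" by simp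
    then obtain v where "v \<in> \<F>" "w x - \<epsilon> < v x" using least[OF x, of "w x - \<epsilon>"] by (meson not_le)
    then show "\<exists>v. continuous_on U v \<and> (\<forall>x\<in>U. sub_at F v x \<and> v x \<le> w x) \<and> w x - \<epsilon> < v x"
      using upper by (auto simp: \<F>_def)
  qed
  have superw: "super_at F w p" if p: "p \<in> U" for p
  proof (cases "w p = G p")
    case True
    have "\<forall>\<^sub>F x in nhds p. w x \<le> G x"
      using eventually_nhds_in_open[OF U p] by eventually_elim (use between in blast)
    then show ?thesis by (rule super_at_touching[of F G p w, OF G(2)[OF p] True])
  next
    case False
    then have lt: "w p < G p" using between[OF p] by simp
    show ?thesis
    proof (rule ccontr)
      assume "\<not> super_at F w p"
      then obtain V where V: "continuous_on U V" "\<And>x. x \<in> U \<Longrightarrow> sub_at F V x"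
        "\<And>x. w x \<le> V x" "\<And>x. V x \<le> max (w x) (G x)" "w p < V p"
        using bump[OF U p F wU subw GU lt] by blast
      have "v0 x \<le> V x \<and> V x \<le> G x" if "x \<in> U" for x
        using between[OF that] V(3,4)[of x] by simp
      then have "V \<in> \<F>" using V(1,2) by (simp add: \<F>_def)
      then show False using upper[OF _ p] V(5) by force
    qed
  qed
  have wbdry: "w x = v0 x" if "x \<in> frontier U" for x
    using that U by (simp add: w_def frontier_def interior_open)
  have closure_between: "v0 x \<le> w x \<and> w x \<le> G x" if "x \<in> closure U" for x
  proof (cases "x \<in> U")
    case False
    then have "x \<in> frontier U" using that U by (simp add: frontier_def interior_open)
    then show ?thesis using wbdry bdry by simp
  qed (use between in blast)
  show thesis
  proof (rule that[of w])
    show "continuous_on (closure U) w"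
      unfolding continuous_on_def
    proof
      fix x assume x: "x \<in> closure U"
      show "(w \<longlongrightarrow> w x) (at x within closure U)"
      proof (cases "x \<in> U")
        case True
        then show ?thesis
          using contw[OF True] by (simp add: isCont_def tendsto_within_subset[of w _ x UNIV])
      next
        case False
        then have "x \<in> frontier U" using x U by (simp add: frontier_def interior_open)
        then have eq: "w x = v0 x" "w x = G x" using wbdry bdry by auto
        show ?thesis
        proof (rule tendsto_sandwich)
          show "(v0 \<longlongrightarrow> w x) (at x within closure U)" "(G \<longlongrightarrow> w x) (at x within closure U)"
            using v0(1) G(1) x eq by (auto simp: continuous_on_def)
          show "\<forall>\<^sub>F y in at x within closure U. v0 y \<le> w y" "\<forall>\<^sub>F y in at x within closure U. w y \<le> G y"
            using closure_between by (auto simp: eventually_at_filter)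
        qed
      qed
    qed
  qed (use between wbdry subw superw in blast)+
qed

section \<open>Eigenvalues of superlevel sets\<close>

lemma sub_at_const: "F p c \<le> 0 \<Longrightarrow> sub_at F (\<lambda>_. c) p"
  unfolding sub_at_def
proof (intro allI impI)
  fix q L assume le: "F p c \<le> 0" and L: "linear L" and ev: "\<forall>\<^sub>F x in nhds p. c \<le> c + quad q L (x - p)"
  have "\<forall>\<^sub>F x in nhds p. quad 0 (\<lambda>_. 0) (x - p) \<le> quad q L (x - p)"
    using ev by eventually_elim (simp add: quad_def[of 0])
  from quad_order(2)[OF L linear_zero this] le show "F p c \<le> q \<bullet> L q" by simp
qed

text \<open>
With \<open>x\<^sub>0\<close> outside the closure and \<open>\<epsilon>\<close> small, \<open>u - \<epsilon> \<surd>|x - x\<^sub>0|\<close> still has an interior maximum, where the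
comparison function has a negative infinity-Laplacian.
\<close>
lemma no_positive_subharmonic:
  fixes \<Omega> :: "'a::euclidean_space set"
  assumes \<Omega>: "open \<Omega>" "bounded \<Omega>" "x1 \<in> \<Omega>"
    and u: "continuous_on (closure \<Omega>) u" "u x1 > 0" "\<And>x. x \<in> frontier \<Omega> \<Longrightarrow> u x = 0"
    and sub: "\<And>p. p \<in> \<Omega> \<Longrightarrow> sub_at F u p" 
  obtains p where "p \<in> \<Omega>" "F p (u p) < 0"
proof -
  have comp: "compact (closure \<Omega>)" using \<Omega>(2) by simp
  obtain x0 where x0: "x0 \<notin> closure \<Omega>"
    using compact_imp_bounded[OF comp] not_bounded_UNIV[where 'a='a] by (metis UNIV_eq_I)
  obtain e where e: "\<And>x. x \<in> closure \<Omega> \<Longrightarrow> dist x0 x \<le> e"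
    using compact_imp_bounded[OF comp] unfolding bounded_any_center[of "closure \<Omega>" x0] by blast
  define D where "D = max e 1"
  have D: "D > 0" "\<And>x. x \<in> closure \<Omega> \<Longrightarrow> dist x x0 \<le> D"
    using e by (auto simp: D_def dist_commute le_max_iff_disj)
  define \<epsilon> where "\<epsilon> = u x1 / (2 * sqrt D)"
  have \<epsilon>: "\<epsilon> > 0" "\<epsilon> * sqrt D < u x1" using u(2) D(1) by (auto simp: \<epsilon>_def)
  define f where "f x = u x - \<epsilon> * sqrt (dist x x0)" for x
  have contf: "continuous_on (closure \<Omega>) f"
    unfolding f_def[abs_def] by (intro continuous_intros u(1))
  have x1: "x1 \<in> closure \<Omega>" using \<Omega>(3) closure_subset[of \<Omega>] by (rule subsetD[rotated])
  then have "closure \<Omega> \<noteq> {}" by (rule ex_in_conv[THEN iffD1, OF exI])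
  from continuous_attains_sup[OF comp this contf]
  obtain p where p: "p \<in> closure \<Omega>" "\<And>x. x \<in> closure \<Omega> \<Longrightarrow> f x \<le> f p"
    by (elim bexE) simp
  have "\<epsilon> * sqrt (dist x1 x0) \<le> \<epsilon> * sqrt D"
    using \<epsilon>(1) D(2)[OF x1] by (intro mult_left_mono) auto
  then have "0 < f x1" using \<epsilon>(2) by (simp add: f_def)
  also have "\<dots> \<le> f p" by (rule p(2)[OF x1])
  finally have "0 < f p" .
  moreover have "0 \<le> \<epsilon> * sqrt (dist p x0)" using \<epsilon>(1) by simp
  ultimately have "0 < u p" by (simp add: f_def)
  then have "p \<notin> frontier \<Omega>" using u(3) by force
  then have p\<Omega>: "p \<in> \<Omega>" using p(1) \<Omega>(1) by (simp add: frontier_def interior_open)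
  have "p \<noteq> x0" using p(1) x0 by blast
  have "\<forall>\<^sub>F x in nhds p. f x \<le> f p"
    using eventually_nhds_in_open[OF \<Omega>(1) p\<Omega>]
    by eventually_elim (use p(2) closure_subset in blast)
  then have "F p (u p) \<le> - (\<epsilon> ^ 3 / 16) * dist p x0 powr (- 5 / 2)"
    unfolding f_def by (rule sub_at_touching_sqrt_dist[OF sub[OF p\<Omega>] \<open>p \<noteq> x0\<close>])
  also have "\<dots> < 0" using \<epsilon>(1) \<open>p \<noteq> x0\<close> by simp
  finally show thesis using that p\<Omega> by blast
qed

text \<open>
Perron's method between the constant \<open>\<delta>\<close> and \<open>min (c g) b\<close>, where \<open>c\<close> makes \<open>c g \<ge> 2 \<delta>\<close> and the barrier
\<open>b = \<delta> + K (u - t)\<close> equals \<open>\<delta>\<close> on the boundary. The slope \<open>K\<close> is so large that \<open>b\<close> can be the smaller of the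
two only where \<open>u < t + \<eta>\<close>. There \<open>b \<le> 2 K \<eta>\<close>, while the equation for \<open>u\<close> gives
\<open>\<Delta>\<^sub>\<infinity> b \<le> - \<nu> a K\<^sup>3 u\<^sup>3 \<le> - \<nu> a K\<^sup>3 t\<^sup>3\<close>, so \<open>b\<close> is a supersolution for \<open>\<mu>\<close> once \<open>\<mu> (2 \<eta>)\<^sup>3 \<le> \<nu> t\<^sup>3\<close>.
\<close>
lemma solvable_of_supersolution:
  fixes U :: "(real^'n::finite) set"
  assumes U: "open U" "bounded U" and a: "continuous_on (closure U) a" "\<And>x. x \<in> U \<Longrightarrow> a x > 0"
    and u: "continuous_on (closure U) u" "\<And>x. x \<in> U \<Longrightarrow> u x > t" "\<And>x. x \<in> frontier U \<Longrightarrow> u x = t"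
      "\<And>x. x \<in> U \<Longrightarrow> super_at (\<lambda>x s. - \<nu> * a x * s ^ 3) u x"
    and "t > 0" "\<nu> > 0" "\<delta> > 0" "\<mu> \<ge> 0"
    and super: "pos_supersolution a \<mu> (closure U) g"
  shows "\<mu> \<in> solvable_set \<delta> a U"
proof (cases "U = {}")
  case True
  then show ?thesis
    using \<open>\<mu> \<ge> 0\<close> by (auto simp: solvable_set_def eigen_equation_def visc_eq_def visc_ge_def visc_le_def)
next
  case False
  let ?F = "\<lambda>x s. - \<mu> * a x * s ^ 3"
  have g: "continuous_on (closure U) g" "\<And>x. x \<in> closure U \<Longrightarrow> g x > 0"
      "\<And>x. x \<in> U \<Longrightarrow> super_at ?F g x"
    using super closure_subset[of U] by (auto simp: pos_supersolution_def)
  have comp: "compact (closure U)" and ne: "closure U \<noteq> {}" using U(2) False by auto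
  obtain y where y: "y \<in> closure U" "\<And>x. x \<in> closure U \<Longrightarrow> g y \<le> g x"
    using continuous_attains_inf[OF comp ne g(1)] by blast
  obtain z where z: "z \<in> closure U" "\<And>x. x \<in> closure U \<Longrightarrow> g x \<le> g z"
    using continuous_attains_sup[OF comp ne g(1)] by blast
  define c where "c = 2 * \<delta> / g y"
  have c: "c > 0" using g(2)[OF y(1)] \<open>\<delta> > 0\<close> by (simp add: c_def)
  have cg_ge: "2 * \<delta> \<le> c * g x" if "x \<in> closure U" for x
  proof -
    have "2 * \<delta> = c * g y" using g(2)[OF y(1)] by (simp add: c_def)
    also have "\<dots> \<le> c * g x" using y(2)[OF that] c by simp
    finally show ?thesis .
  qed
  \<comment> \<open>The choice of \<open>\<eta>\<close> gives \<open>\<mu> (2 \<eta>)\<^sup>3 \<le> \<nu> t\<^sup>3\<close> because \<open>\<theta>\<^sup>3 \<le> \<theta>\<close> for \<open>\<theta> \<le> 1\<close>.\<close>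
  define \<theta> where "\<theta> = min 1 (\<nu> / (\<mu> + 1))"
  define \<eta> where "\<eta> = t * \<theta> / 2"
  have \<theta>: "0 < \<theta>" "\<theta> \<le> 1" using \<open>\<nu> > 0\<close> \<open>\<mu> \<ge> 0\<close> by (auto simp: \<theta>_def)
  have \<eta>: "\<eta> > 0" using \<theta> \<open>t > 0\<close> by (simp add: \<eta>_def)
  have \<mu>\<eta>: "\<mu> * (2 * \<eta>) ^ 3 \<le> \<nu> * t ^ 3"
  proof -
    have "\<theta> ^ 3 \<le> \<theta>" using \<theta> power_decreasing[of 1 3 \<theta>] by simp
    then have "\<mu> * \<theta> ^ 3 \<le> (\<mu> + 1) * \<theta>" using \<open>\<mu> \<ge> 0\<close> \<theta>(1) by (intro mult_mono) auto
    also have "\<dots> \<le> (\<mu> + 1) * (\<nu> / (\<mu> + 1))"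
      using \<open>\<mu> \<ge> 0\<close> by (intro mult_left_mono) (auto simp: \<theta>_def)
    also have "\<dots> = \<nu>" using \<open>\<mu> \<ge> 0\<close> by simp
    finally have "\<mu> * \<theta> ^ 3 * t ^ 3 \<le> \<nu> * t ^ 3" using \<open>t > 0\<close> by (intro mult_right_mono) auto
    then show ?thesis by (simp add: \<eta>_def power_mult_distrib mult_ac)
  qed
  define K where "K = (c * g z + \<delta>) / \<eta>"
  have cgz: "0 < c * g z" using c g(2)[OF z(1)] by simp
  have K: "K > 0" "K * \<eta> = c * g z + \<delta>" using cgz \<open>\<delta> > 0\<close> \<eta> by (auto simp: K_def)
  define b where "b x = K * u x + (\<delta> - K * t)" for x
  define G where "G x = min (c * g x) (b x)" for x
  have b_ge: "\<delta> < b x" if "x \<in> U" for x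
    using mult_strict_left_mono[OF u(2)[OF that] K(1)] by (simp add: b_def)
  have contb: "continuous_on (closure U) b"
    unfolding b_def[abs_def] by (intro continuous_intros u(1))
  have superG: "super_at ?F G x" if x: "x \<in> U" for x
  proof (cases "c * g x \<le> b x")
    case True
    have "super_at ?F (\<lambda>x. c * g x) x"
      by (rule super_at_affine[OF g(3)[OF x] c, of _ 0]) (simp_all add: power_mult_distrib)
    then show ?thesis
      by (rule super_at_touching) (use True in \<open>simp_all add: G_def\<close>)
  next
    case False
    have xc: "x \<in> closure U" using x closure_subset by blast
    have "b x < c * g z" using False mult_left_mono[OF z(2)[OF xc], of c] c by linarith
    then have "K * (u x - t) < K * \<eta>" unfolding K(2) using \<open>\<delta> > 0\<close> by (simp add: b_def right_diff_distrib)
    then have "b x \<le> K * (2 * \<eta>)" using K(2) cgz by (simp add: b_def right_diff_distrib)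
    then have "b x ^ 3 \<le> (K * (2 * \<eta>)) ^ 3"
      using b_ge[OF x] \<open>\<delta> > 0\<close> by (intro power_mono) auto
    then have "\<mu> * b x ^ 3 \<le> K ^ 3 * (\<mu> * (2 * \<eta>) ^ 3)"
      using mult_left_mono[OF _ \<open>\<mu> \<ge> 0\<close>] by (force simp: power_mult_distrib mult_ac)
    also have "\<dots> \<le> K ^ 3 * (\<nu> * t ^ 3)" using \<mu>\<eta> K(1) by (intro mult_left_mono) auto
    also have "\<dots> \<le> K ^ 3 * (\<nu> * u x ^ 3)"
      using K(1) \<open>\<nu> > 0\<close> \<open>t > 0\<close> u(2)[OF x] by (intro mult_left_mono power_mono) auto
    finally have "a x * (\<mu> * b x ^ 3) \<le> a x * (K ^ 3 * (\<nu> * u x ^ 3))"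
      using a(2)[OF x] by (intro mult_left_mono) auto
    then have "K ^ 3 * (- \<nu> * a x * u x ^ 3) \<le> - \<mu> * a x * b x ^ 3" by (simp add: mult_ac)
    then have "super_at ?F b x"
      by (intro super_at_affine[OF u(4)[OF x] K(1), of b "\<delta> - K * t"]) (simp_all add: b_def)
    then show ?thesis
      by (rule super_at_touching) (use False in \<open>simp_all add: G_def\<close>)
  qed
  have contF: "continuous_on (U \<times> UNIV) (\<lambda>(x, s). ?F x s)"
    using closure_subset[of U] unfolding case_prod_unfold
    by (intro continuous_intros continuous_on_compose2[OF a(1) continuous_on_fst[OF continuous_on_id]]) auto
  have G_ge: "\<delta> \<le> G x" if "x \<in> U" for x
    using b_ge[OF that] cg_ge[of x] that closure_subset \<open>\<delta> > 0\<close> by (force simp: G_def)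
  have G_bdry: "\<delta> = G x" if "x \<in> frontier U" for x
    using cg_ge[of x] u(3)[OF that] that \<open>\<delta> > 0\<close> by (simp add: G_def b_def frontier_def)
  have contG: "continuous_on (closure U) G"
    unfolding G_def[abs_def] by (intro continuous_intros g contb)
  have sub\<delta>: "sub_at ?F (\<lambda>_. \<delta>) x" if "x \<in> U" for x
    using a(2)[OF that] \<open>\<mu> \<ge> 0\<close> \<open>\<delta> > 0\<close> by (intro sub_at_const) (simp add: less_imp_le)
  obtain w where w: "continuous_on (closure U) w" "\<And>x. x \<in> U \<Longrightarrow> \<delta> \<le> w x \<and> w x \<le> G x"
    "\<And>x. x \<in> frontier U \<Longrightarrow> w x = \<delta>" "\<And>x. x \<in> U \<Longrightarrow> sub_at ?F w x \<and> super_at ?F w x"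
    by (rule perron[OF U(1) contF continuous_on_const[of "closure U" \<delta>] sub\<delta> contG superG G_ge G_bdry])
      blast+
  have "continuous_on U w" by (rule continuous_on_subset[OF w(1) closure_subset])
  then have "eigen_equation a \<mu> U w"
    using w(4) by (simp add: eigen_equation_def visc_eq_def visc_ge_iff[OF U(1)] visc_le_iff[OF U(1)])
  moreover have "\<forall>x\<in>U. 0 < w x" using w(2) \<open>\<delta> > 0\<close> by force
  ultimately show ?thesis using w(1,3) \<open>\<mu> \<ge> 0\<close> by (auto simp: solvable_set_def)
qed

lemma first_eigenvalue_ge: "\<mu> \<in> solvable_set \<delta> a U \<Longrightarrow> ereal \<mu> \<le> first_eigenvalue \<delta> a U"
  unfolding first_eigenvalue_def by (rule SUP_upper)

lemma superlevel_open:
  assumes "open \<Omega>" "continuous_on \<Omega> u"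
  shows "open {x\<in>\<Omega>. u x > (t::real)}"
  using continuous_open_preimage[OF assms(2,1) open_greaterThan[of t]]
  by (simp add: vimage_def Int_def)

lemma closure_superlevel:
  fixes u :: "'a::topological_space \<Rightarrow> real"
  assumes \<Omega>: "open \<Omega>" and u: "continuous_on (closure \<Omega>) u" "\<And>x. x \<in> frontier \<Omega> \<Longrightarrow> u x = 0" and "t > 0"
  shows "closure {x\<in>\<Omega>. u x > t} \<subseteq> {x\<in>\<Omega>. u x \<ge> t}"
    and "x \<in> frontier {x\<in>\<Omega>. u x > t} \<Longrightarrow> u x = t"
proof -
  have "closed {x\<in>closure \<Omega>. t \<le> u x}"
    using continuous_closed_preimage[OF u(1) closed_closure closed_atLeast[of t]]
    by (simp add: vimage_def Int_def)
  moreover have "{x\<in>\<Omega>. u x > t} \<subseteq> {x\<in>closure \<Omega>. t \<le> u x}" using closure_subset by force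
  ultimately have "closure {x\<in>\<Omega>. u x > t} \<subseteq> {x\<in>closure \<Omega>. t \<le> u x}" by (rule closure_minimal[rotated])
  moreover have "{x\<in>closure \<Omega>. t \<le> u x} \<subseteq> {x\<in>\<Omega>. u x \<ge> t}"
    using u(2) \<Omega> \<open>t > 0\<close> by (force simp: frontier_def interior_open)
  ultimately show sub: "closure {x\<in>\<Omega>. u x > t} \<subseteq> {x\<in>\<Omega>. u x \<ge> t}" by blast
  assume x: "x \<in> frontier {x\<in>\<Omega>. u x > t}"
  have "open {x\<in>\<Omega>. u x > t}"
    by (rule superlevel_open[OF \<Omega> continuous_on_subset[OF u(1) closure_subset]])
  with x have "x \<notin> {x\<in>\<Omega>. u x > t}" "x \<in> closure {x\<in>\<Omega>. u x > t}"
    by (auto simp: frontier_def interior_open)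
  with sub show "u x = t" by (force dest: subsetD)
qed

text \<open>
Subtracting half of the infimum \<open>m\<close> of \<open>w\<close> over the part of \<open>K\<close> in the same component. With \<open>m \<ge> w / H\<close>, what
is left is at most \<open>w / \<rho>\<close>, where \<open>1 / \<rho> = 1 - 1 / (2 H)\<close>, so \<open>\<mu>\<close> may grow by the factor \<open>\<rho>\<^sup>3\<close>.
\<close>
lemma harnack_improvement:
  fixes U :: "'a::euclidean_space set"
  assumes U: "open U" and K: "compact K" "K \<subseteq> U" and a: "\<And>x. x \<in> U \<Longrightarrow> a x > 0"
  obtains \<theta> where "\<theta> > 1"
    "\<And>\<mu> w. \<mu> \<ge> 0 \<Longrightarrow> pos_supersolution a \<mu> U w \<Longrightarrow> \<exists>g. pos_supersolution a (\<theta> * \<mu>) K g"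
proof -
  obtain H where H: "H \<ge> 1" "\<And>w x y. pos_superharmonic U w \<Longrightarrow> x \<in> K \<Longrightarrow> y \<in> K \<Longrightarrow>
      connected_component U x y \<Longrightarrow> w x \<le> H * w y"
    using harnack_compact[OF U K] by blast
  define \<rho> where "\<rho> = 2 * H / (2 * H - 1)"
  have \<rho>: "\<rho> > 1" using H(1) by (simp add: \<rho>_def field_simps)
  show thesis
  proof (rule that[of "\<rho> ^ 3"])
    show "1 < \<rho> ^ 3" using \<rho> by (rule one_less_power) simp
    fix \<mu> w
    assume \<mu>: "\<mu> \<ge> 0" and pw: "pos_supersolution a \<mu> U w"
    then have w: "continuous_on U w" "\<And>x. x \<in> U \<Longrightarrow> w x > 0"
      "\<And>x. x \<in> U \<Longrightarrow> super_at (\<lambda>x s. - \<mu> * a x * s ^ 3) w x"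
      by (auto simp: pos_supersolution_def)
    have ps: "pos_superharmonic U w"
      by (rule pos_supersolution_imp_pos_superharmonic[OF pw \<mu> a])
    define m where "m x = (INF y\<in>K \<inter> connected_component_set U x. w y)" for x
    define g where "g x = w x - m x / 2" for x
    have m: "m x \<le> w x" "w x \<le> H * m x" if x: "x \<in> K" for x
    proof -
      have xc: "x \<in> K \<inter> connected_component_set U x"
        using x K(2) by (auto simp: connected_component_refl_eq)
      show "m x \<le> w x"
        unfolding m_def using K(2) w(2) xc by (intro cINF_lower bdd_belowI2[of _ 0]) (auto simp: less_imp_le)
      have "w x / H \<le> m x"
        unfolding m_def using xc H(2)[OF ps x] H(1) by (intro cINF_greatest) (auto simp: field_simps)
      then show "w x \<le> H * m x" using H(1) by (simp add: field_simps)
    qed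
    have loc: "\<forall>\<^sub>F x in nhds p. g x = 1 * w x + (- m p / 2)" if p: "p \<in> U" for p
    proof -
      have "p \<in> connected_component_set U p" using p by (simp add: connected_component_refl_eq)
      from eventually_nhds_in_open[OF open_connected_component[OF U] this]
      show ?thesis
      proof eventually_elim
        case (elim x)
        then have "connected_component_set U x = connected_component_set U p"
          using connected_component_eq by blast
        then show ?case by (simp add: g_def m_def)
      qed
    qed
    have "isCont g p" if "p \<in> U" for p
    proof -
      have "isCont (\<lambda>x. 1 * w x + (- m p / 2)) p"
        using w(1) that U by (intro continuous_intros) (simp add: continuous_on_eq_continuous_at)
      then show ?thesis using isCont_cong[OF loc[OF that]] by simp
    qed
    then have "continuous_on K g" using K(2) by (intro continuous_at_imp_continuous_on) auto
    moreover have gpos: "g x > 0" if "x \<in> K" for x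
      using m(1)[OF that] w(2)[of x] K(2) that by (auto simp: g_def)
    moreover have "super_at (\<lambda>x s. - (\<rho> ^ 3 * \<mu>) * a x * s ^ 3) g x" if x: "x \<in> K" for x
    proof -
      have xU: "x \<in> U" using x K(2) by blast
      have "w x / H \<le> m x" using m(2)[OF x] H(1) by (simp add: field_simps)
      then have "g x \<le> w x - w x / H / 2" by (simp add: g_def)
      also have "\<dots> = w x / \<rho>" using H(1) by (simp add: \<rho>_def field_simps)
      finally have "\<rho> * g x \<le> w x" using \<rho> by (simp add: field_simps)
      moreover have "0 \<le> \<rho> * g x" using gpos[OF x] \<rho> by simp
      ultimately have "(\<rho> * g x) ^ 3 \<le> w x ^ 3" by (intro power_mono)
      then have "\<mu> * a x * (\<rho> ^ 3 * g x ^ 3) \<le> \<mu> * a x * w x ^ 3"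
        using \<mu> a[OF xU] by (intro mult_left_mono) (auto simp: power_mult_distrib)
      then show ?thesis
        by (intro super_at_affine[OF w(3)[OF xU] zero_less_one loc[OF xU]]) (simp add: mult_ac)
    qed
    ultimately show "\<exists>g. pos_supersolution a (\<rho> ^ 3 * \<mu>) K g"
      unfolding pos_supersolution_def by blast
  qed
qed

lemma solvable_imp_pos_supersolution:
  assumes "open U" "\<mu> \<in> solvable_set \<delta> a U"
  shows "\<mu> \<ge> 0" "\<exists>w. pos_supersolution a \<mu> U w"
  using assms(2)
  by (auto simp: solvable_set_def eigen_equation_def visc_eq_def visc_le_iff[OF assms(1)] pos_supersolution_def)

theorem lemma4p4:
  fixes \<Omega> :: "(real^'n::finite) set" and a u :: "real^'n \<Rightarrow> real" and \<delta> :: real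
  assumes "CARD('n) \<ge> 2"
    and "open \<Omega>" and "connected \<Omega>" and "\<Omega> \<noteq> {}" and "bounded \<Omega>"
    and "continuous_on \<Omega> a"
    and "\<exists>C. AE x in lebesgue_on \<Omega>. \<bar>a x\<bar> \<le> C"
    and "\<forall>x\<in>\<Omega>. a x > 0"
    and "\<delta> > 0"
    and "first_eigenfunction \<delta> a \<Omega> u"
    and "(SUP x\<in>\<Omega>. u x) = 1"
  shows "strict_mono_on {0<..<1} (\<lambda>t. first_eigenvalue \<delta> a {x\<in>\<Omega>. u x > t}) \<and>
    ((\<lambda>t. first_eigenvalue \<delta> a {x\<in>\<Omega>. u x > t}) \<longlongrightarrow> \<infinity>) (at_left 1)"
proof -
  note \<Omega> = assms(2,4,5)
  define \<mu>0 where "\<mu>0 = real_of_ereal (first_eigenvalue \<delta> a \<Omega>)"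
  let ?F = "\<lambda>\<mu> x s. - \<mu> * a x * s ^ 3"
  let ?U = "\<lambda>t. {x\<in>\<Omega>. u x > t}"
  have u: "continuous_on (closure \<Omega>) u" "\<And>x. x \<in> \<Omega> \<Longrightarrow> u x > 0" "\<And>x. x \<in> frontier \<Omega> \<Longrightarrow> u x = 0"
    and sub: "\<And>x. x \<in> \<Omega> \<Longrightarrow> sub_at (?F \<mu>0) u x" and super: "\<And>x. x \<in> \<Omega> \<Longrightarrow> super_at (?F \<mu>0) u x"
    using assms(10) by (auto simp: first_eigenfunction_def eigen_equation_def visc_eq_def \<mu>0_def
        visc_ge_iff[OF \<Omega>(1)] visc_le_iff[OF \<Omega>(1)])
  have u\<Omega>: "continuous_on \<Omega> u" by (rule continuous_on_subset[OF u(1) closure_subset])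
  have a: "\<And>x. x \<in> \<Omega> \<Longrightarrow> a x > 0" using assms(8) by blast
  \<comment> \<open>If the first eigenvalue were infinite, \<open>\<mu>0\<close> would be the default value 0, which is excluded here as well.\<close>
  have \<mu>0: "\<mu>0 > 0"
  proof -
    obtain x1 where "x1 \<in> \<Omega>" using \<Omega>(2) by blast
    then obtain p where "p \<in> \<Omega>" "?F \<mu>0 p (u p) < 0"
      using no_positive_subharmonic[OF \<Omega>(1,3) _ u(1) u(2) u(3) sub] by blast
    then show ?thesis using a[of p] u(2)[of p] by (simp add: zero_less_mult_iff)
  qed
  have "compact (u ` closure \<Omega>)" using \<Omega>(3) u(1) by (intro compact_continuous_image) auto
  then have bdd: "bdd_above (u ` \<Omega>)"
    using bounded_imp_bdd_above[OF compact_imp_bounded] bdd_above_mono image_mono[OF closure_subset] by metis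
  have u_le: "u x \<le> 1" if "x \<in> \<Omega>" for x
    using cSUP_upper[OF that bdd] assms(11) by simp
  have ne: "?U t \<noteq> {}" if "t < 1" for t
    using less_cSUP_iff[OF \<Omega>(2) bdd, of t] assms(11) that by auto
  have Uopen: "open (?U t)" for t by (rule superlevel_open[OF \<Omega>(1) u\<Omega>])
  have Ubdd: "bounded (?U t)" for t by (rule bounded_subset[OF \<Omega>(3)]) auto
  have Ucl: "closure (?U t) \<subseteq> {x\<in>\<Omega>. u x \<ge> t}" if "t > 0" for t
    by (rule closure_superlevel(1)[OF \<Omega>(1) u(1,3) that])
  have solvable: "\<mu> \<in> solvable_set \<delta> a (?U t)"
    if t: "t > 0" and "\<mu> \<ge> 0" and g: "pos_supersolution a \<mu> (closure (?U t)) g" for t \<mu> g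
  proof (rule solvable_of_supersolution[where u = u and t = t and \<nu> = \<mu>0 and g = g])
    have sub\<Omega>: "closure (?U t) \<subseteq> \<Omega>" using Ucl[OF t] by blast
    show "continuous_on (closure (?U t)) a" "continuous_on (closure (?U t)) u"
      using continuous_on_subset[OF _ sub\<Omega>] assms(6) u\<Omega> by auto
    show "u x = t" if "x \<in> frontier (?U t)" for x
      by (rule closure_superlevel(2)[OF \<Omega>(1) u(1,3) t that])
  qed (use that a super \<mu>0 Uopen Ubdd \<open>\<delta> > 0\<close> in auto)
  have strict: "first_eigenvalue \<delta> a (?U s) < first_eigenvalue \<delta> a (?U t)"
    if st: "0 < s" "s < t" "t < 1" for s t
  proof -
    let ?K = "closure (?U t)"
    have t: "t > 0" using st by simp
    have K: "compact ?K" "?K \<subseteq> ?U s" using Ucl[OF t] Ubdd st by auto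
    have aU: "a x > 0" if "x \<in> ?U s" for x using a that by blast
    obtain \<theta> where \<theta>: "\<theta> > 1" "\<And>\<mu> w. \<mu> \<ge> 0 \<Longrightarrow> pos_supersolution a \<mu> (?U s) w \<Longrightarrow>
        \<exists>g. pos_supersolution a (\<theta> * \<mu>) ?K g"
      using harnack_improvement[where a = a, OF Uopen K aU] by blast
    have step: "\<theta> * \<mu> \<in> solvable_set \<delta> a (?U t)" if \<mu>: "\<mu> \<in> solvable_set \<delta> a (?U s)" for \<mu>
    proof -
      have "\<mu> \<ge> 0" by (rule solvable_imp_pos_supersolution(1)[OF Uopen \<mu>])
      moreover obtain g where "pos_supersolution a (\<theta> * \<mu>) ?K g"
        using solvable_imp_pos_supersolution[OF Uopen \<mu>] \<theta>(2) by blast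
      ultimately show ?thesis using \<theta>(1) by (intro solvable[OF t]) auto
    qed
    have aU_cont: "continuous_on (?U s) a" using assms(6) by (rule continuous_on_subset) auto
    have s_ne: "?U s \<noteq> {}" using ne st by simp
    obtain B where "\<And>\<mu> w. \<mu> \<ge> 0 \<Longrightarrow> pos_supersolution a \<mu> (?U s) w \<Longrightarrow> \<mu> \<le> B"
      using eigenvalue_bound[where a = a, OF Uopen s_ne aU_cont aU] by blast
    then have B: "\<mu> \<le> B" if "\<mu> \<in> solvable_set \<delta> a (?U s)" for \<mu>
      using solvable_imp_pos_supersolution[OF Uopen that] by blast
    have le: "first_eigenvalue \<delta> a (?U s) \<le> ereal b" if "\<And>\<mu>. \<mu> \<in> solvable_set \<delta> a (?U s) \<Longrightarrow> \<mu> \<le> b" for b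
      unfolding first_eigenvalue_def using that by (auto intro: SUP_least)
    have "pos_supersolution a \<mu>0 (closure (?U s)) u"
      unfolding pos_supersolution_def
      using Ucl[OF st(1)] u(2) super by (auto intro!: continuous_on_subset[OF u\<Omega>])
    then have \<mu>0s: "\<mu>0 \<in> solvable_set \<delta> a (?U s)"
      using \<mu>0 by (intro solvable[OF st(1)]) auto
    have ge: "ereal \<mu>0 \<le> first_eigenvalue \<delta> a (?U s)" by (rule first_eigenvalue_ge[OF \<mu>0s])
    obtain l where l: "first_eigenvalue \<delta> a (?U s) = ereal l"
      using ge le[OF B] by (cases "first_eigenvalue \<delta> a (?U s)") auto
    have "l > 0" using ge \<mu>0 l by simp
    show ?thesis
    proof (cases "first_eigenvalue \<delta> a (?U t)")
      case (real b)
      have "\<mu> \<le> b / \<theta>" if "\<mu> \<in> solvable_set \<delta> a (?U s)" for \<mu>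
        using first_eigenvalue_ge[OF step[OF that]] real \<theta>(1) by (simp add: field_simps)
      then have "l \<le> b / \<theta>" using le[of "b / \<theta>"] l by simp
      then have "l * \<theta> \<le> b" using \<theta>(1) by (simp add: field_simps)
      moreover have "l * 1 < l * \<theta>" using \<theta>(1) \<open>l > 0\<close> by (intro mult_strict_left_mono)
      ultimately show ?thesis using l real by simp
    next
      case PInf
      then show ?thesis using l by simp
    next
      case MInf
      from first_eigenvalue_ge[OF step[OF \<mu>0s]] MInf show ?thesis by simp
    qed
  qed
  have sq: "t\<^sup>2 < t" "t\<^sup>2 < 1" if "0 < t" "t < 1" for t :: real
  proof -
    show "t\<^sup>2 < t" using mult_strict_left_mono[OF that(2,1)] by (simp add: power2_eq_square)
    with that show "t\<^sup>2 < 1" by linarith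
  qed
  have lower: "ereal (\<mu>0 / (1 - t\<^sup>2) ^ 3) \<le> first_eigenvalue \<delta> a (?U t)" if t: "0 < t" "t < 1" for t
  proof (rule first_eigenvalue_ge, rule solvable[OF t(1)])
    note t2 = sq[OF t]
    show "0 \<le> \<mu>0 / (1 - t\<^sup>2) ^ 3" using \<mu>0 t2 by simp
    have "continuous_on (closure (?U t)) (\<lambda>x. u x - t\<^sup>2)"
      using Ucl[OF t(1)] by (intro continuous_intros continuous_on_subset[OF u\<Omega>]) auto
    moreover have "0 < u x - t\<^sup>2" if "x \<in> closure (?U t)" for x
      using Ucl[OF t(1)] that t2 by force
    moreover have "super_at (?F (\<mu>0 / (1 - t\<^sup>2) ^ 3)) (\<lambda>x. u x - t\<^sup>2) x" if x: "x \<in> closure (?U t)" for x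
    proof (rule super_at_affine[OF super zero_less_one, of x _ "- t\<^sup>2"])
      have ux: "t \<le> u x" "u x \<le> 1" "x \<in> \<Omega>" using subsetD[OF Ucl[OF t(1)] x] u_le by auto
      \<comment> \<open>The normalisation \<open>u \<le> 1\<close> makes \<open>(u - t\<^sup>2) / (1 - t\<^sup>2) \<le> u\<close>.\<close>
      have "u x * t\<^sup>2 \<le> 1 * t\<^sup>2" using ux by (intro mult_right_mono) auto
      then have "(u x - t\<^sup>2) / (1 - t\<^sup>2) \<le> u x" using t2 by (simp add: field_simps)
      moreover have "0 \<le> (u x - t\<^sup>2) / (1 - t\<^sup>2)" using ux t2 by simp
      ultimately have "((u x - t\<^sup>2) / (1 - t\<^sup>2)) ^ 3 \<le> u x ^ 3" by (rule power_mono)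
      then have "\<mu>0 * a x * ((u x - t\<^sup>2) / (1 - t\<^sup>2)) ^ 3 \<le> \<mu>0 * a x * u x ^ 3"
        using \<mu>0 a[OF ux(3)] by (intro mult_left_mono) auto
      then show "1 ^ 3 * ?F \<mu>0 x (u x) \<le> ?F (\<mu>0 / (1 - t\<^sup>2) ^ 3) x (u x - t\<^sup>2)"
        by (simp add: power_divide)
      show "x \<in> \<Omega>" by fact
    qed simp
    ultimately show "pos_supersolution a (\<mu>0 / (1 - t\<^sup>2) ^ 3) (closure (?U t)) (\<lambda>x. u x - t\<^sup>2)"
      unfolding pos_supersolution_def by blast
  qed
  have ev: "\<forall>\<^sub>F t in at_left (1::real). 0 < t \<and> t < 1"
    using eventually_at_left_real[of 0 1] by (simp add: conj_commute)
  have "filterlim (\<lambda>t. inverse ((1 - t\<^sup>2) ^ 3 / \<mu>0)) at_top (at_left (1::real))"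
  proof (rule filterlim_inverse_at_top)
    have "((\<lambda>t. (1 - t\<^sup>2) ^ 3 / \<mu>0) \<longlongrightarrow> (1 - 1\<^sup>2) ^ 3 / \<mu>0) (at_left (1::real))"
      using \<mu>0 by (intro tendsto_intros) auto
    then show "((\<lambda>t. (1 - t\<^sup>2) ^ 3 / \<mu>0) \<longlongrightarrow> 0) (at_left (1::real))" by simp
    show "\<forall>\<^sub>F t in at_left (1::real). 0 < (1 - t\<^sup>2) ^ 3 / \<mu>0"
      using ev by eventually_elim (use sq(2) \<mu>0 in simp)
  qed
  then have blowup: "((\<lambda>t. ereal (\<mu>0 / (1 - t\<^sup>2) ^ 3)) \<longlongrightarrow> \<infinity>) (at_left (1::real))"
    by (simp add: tendsto_PInfty_eq_at_top)
  have "\<forall>\<^sub>F t in at_left 1. ereal r < first_eigenvalue \<delta> a (?U t)" for r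
    using blowup[unfolded tendsto_PInfty, rule_format, of r] ev
  proof eventually_elim
    case (elim t)
    then have "ereal (\<mu>0 / (1 - t\<^sup>2) ^ 3) \<le> first_eigenvalue \<delta> a (?U t)" by (intro lower) simp_all
    with elim(1) show ?case by (rule less_le_trans)
  qed
  then have "((\<lambda>t. first_eigenvalue \<delta> a (?U t)) \<longlongrightarrow> \<infinity>) (at_left 1)"
    by (simp add: tendsto_PInfty)
  moreover have "strict_mono_on {0<..<1} (\<lambda>t. first_eigenvalue \<delta> a (?U t))"
    by (rule strict_mono_onI) (use strict in auto)
  ultimately show ?thesis by blast
qed

end
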